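(* Suppose that $0<\tau_i<2/L_i$ for all $i\in\{1,\dots,N\}$, $0<\beta\le 0.5/\max_i\tau_i$, and $\sum_{k=1}^\infty\varepsilon_k<\infty$. Then the sequence $\{\mathbf u^k\}=\{\mathrm{col}\{\mathbf x^k,\boldsymbol\alpha^k\}\}$ generated by the inexact recursion (D-iPGM) described in the context satisfies: 1. for every $\mathbf u^*=\mathrm{col}\{\mathbf x^*,\boldsymbol\alpha^*\}\in\mathcal M^*$ and every $k\ge 0$, $$\|\mathbf u^{k+1}-\mathbf u^*\|_{\mathbf H}^2\le \|\mathbf u^k-\mathbf u^*\|_{\mathbf H}^2-\|\mathbf u^k-\tilde{\mathbf u}^k\|_{\widehat{\mathbf H}_1}^2+2\langle\tilde{\mathbf x}^k-\mathbf x^*,\mathbf d^k\rangle;$$ 2. the sequence $\{\mathbf u^k\}$ is bounded; 3. there exists $\mathbf u^\infty=\mathrm{col}\{\mathbf x^\infty,\boldsymbol\alpha^\infty\}\in\mathcal M^*$ such that $\lim_{k\to\infty}\mathbf u^k=\mathbf u^\infty$; that is, $\mathbf x^\infty=\mathbf 1_N\otimes \mathrm x^\infty$ for some $\mathrm x^\infty\in\mathbb R^n$, and $\mathrm x^\infty$ solves $\min_{\mathrm x\in\mathbb R^n}\sum_{i=1}^N(f_i(\mathrm x)+g_i(\mathrm x))$.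
   Context: Problem. Let $N,n\ge1$ and consider $\min_{\mathrm x\in\mathbb R^n}\sum_{i=1}^N (f_i(\mathrm x)+g_i(\mathrm x))$, where each $f_i:\mathbb R^n\to\mathbb R$ is convex and $L_i$-smooth (differentiable with $L_i$-Lipschitz gradient, $L_i>0$), and each $g_i:\mathbb R^n\to\mathbb R\cup\{\infty\}$ is proper, closed and convex (not necessarily smooth). An optimal solution is assumed to exist. For $\mathbf x=\mathrm{col}\{\mathrm x_1,\dots,\mathrm x_N\}\in\mathbb R^{Nn}$ (stacked vector) put $F(\mathbf x)=\sum_i f_i(\mathrm x_i)$, $G(\mathbf x)=\sum_i g_i(\mathrm x_i)$, $\mathbf L_F=\mathrm{diag}\{L_1\mathbf I_n,\dots,L_N\mathbf I_n\}$. Network. $\mathcal G=(\mathcal V,\mathcal E)$ is an undirected connected graph on $N$ vertices. $W=[W_{ij}]\in\mathbb R^{N\times N}$ is symmetric and doubly stochastic, the null space of $\mathbf I-W$ is $\mathrm{Span}(\mathbf 1)$, $W_{ij}=W_{ji}=0$ if $(i,j)\notin\mathcal E$ and $i\ne j$, and $W_{ij}>0$ otherwise. Let $\mathbf W=W\otimes\mathbf I_n$ and $\mathbf V=\sqrt{\mathbf I-\mathbf W}$ (positive semidefinite square root). The problem is equivalent to $\min_{\mathbf x}F(\mathbf x)+G(\mathbf x)$ subject to $\mathbf V\mathbf x=\mathbf 0$. Saddle points. $\mathcal M=\mathbb R^{Nn}\times\mathbb R^{Nn}$, $L(\mathbf x,\boldsymbol\alpha)=F(\mathbf x)+G(\mathbf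 x)-\langle\boldsymbol\alpha,\mathbf V\mathbf x\rangle$, and $\mathcal M^*\subseteq\mathcal M$ is the set of $(\mathbf x^*,\boldsymbol\alpha^* )$ with $L(\mathbf x^*,\boldsymbol\alpha)\le L(\mathbf x^*,\boldsymbol\alpha^* )\le L(\mathbf x,\boldsymbol\alpha^* )$ for all $(\mathbf x,\boldsymbol\alpha)\in\mathcal M$. Strong duality is assumed, so that $\mathcal M^*\neq\emptyset$. Norms. For a symmetric positive definite matrix $\mathcal H$, $\|\mathbf z\|_{\mathcal H}^2=\langle\mathbf z,\mathcal H\mathbf z\rangle$ and $\mathrm{prox}_\theta^{\mathcal H}(\mathbf x)=\arg\min_{\mathbf y}\{\theta(\mathbf y)+\tfrac12\|\mathbf y-\mathbf x\|_{\mathcal H}^2\}$. Matrices. With $\tau_i>0$, $\beta>0$, $\Gamma=\mathrm{diag}\{\tau_1\mathbf I_n,\dots,\tau_N\mathbf I_n\}$, set $$\mathbf Q=\begin{pmatrix}\Gamma^{-1}&\mathbf V\\ \mathbf 0&\frac1\beta\mathbf I\end{pmatrix},\quad \mathbf M=\begin{pmatrix}\mathbf I&\Gamma\mathbf V\\ \mathbf 0&\mathbf I\end{pmatrix},\quad \mathbf H=\mathbf Q\mathbf M^{-1},\quad \mathbf G=\mathbf Q^{\sf T}+\mathbf Q-\mathbf M^{\sf T}\mathbf H\mathbf M,\quad \widehat{\mathbf H}_1=\mathbf G-\tfrac12\mathrm{diag}\{\mathbf L_F,\mathbf 0\}.$$ Algorithm (D-iPGM). Let $\{\varepsilon_k\}$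 be a sequence of nonnegative numbers. Starting from any $\mathbf x^0\in\mathbb R^{Nn}$ and $\boldsymbol\alpha^0=\mathbf 0$, for $k\ge0$, $$\tilde{\mathbf x}^k=\mathrm{prox}_G^{\Gamma^{-1}}\big(\mathbf x^k-\Gamma(\nabla F(\mathbf x^k)-\mathbf V\boldsymbol\alpha^k-\mathbf d^k)\big),\quad \tilde{\boldsymbol\alpha}^k=\boldsymbol\alpha^k-\beta\mathbf V\tilde{\mathbf x}^k,\quad \mathbf u^{k+1}=\mathbf u^k-\mathbf M(\mathbf u^k-\tilde{\mathbf u}^k),$$ where $\mathbf u^k=\mathrm{col}\{\mathbf x^k,\boldsymbol\alpha^k\}$, $\tilde{\mathbf u}^k=\mathrm{col}\{\tilde{\mathbf x}^k,\tilde{\boldsymbol\alpha}^k\}$, and $\mathbf d^k=\mathrm{col}\{\mathrm d_1^k,\dots,\mathrm d_N^k\}$ is an arbitrary error vector (the residual of the inexactly solved proximal subproblems) with $\|\mathrm d_i^k\|\le\varepsilon_k$ for all $i$. *)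

theory Defs
  imports "HOL-Analysis.Analysis"
begin

text \<open>
  Vectors of $R^{Nn}$ are indexed by pairs: component \<open>(i, j)\<close> is coordinate \<open>j\<close> of agent \<open>i\<close>.
  Vectors of $R^{Nn} \times R^{Nn}$, stacked as \<open>col{x, \<alpha>}\<close>, are indexed by the
  corresponding sum type, so that all block matrices below are ordinary square matrices.
\<close>

type_synonym ('N, 'n) svec = "real ^ ('N \<times> 'n)"
type_synonym ('N, 'n) smat = "real ^ ('N \<times> 'n) ^ ('N \<times> 'n)"
type_synonym ('N, 'n) bmat = "real ^ (('N \<times> 'n) + ('N \<times> 'n)) ^ (('N \<times> 'n) + ('N \<times> 'n))"

definition agent :: "('N::finite, 'n::finite) svec \<Rightarrow> 'N \<Rightarrow> real ^ 'n" where
  "agent x i = (\<chi> j. x $ (i, j))"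

definition kron_vec :: "real ^ 'N \<Rightarrow> real ^ 'n \<Rightarrow> ('N::finite, 'n::finite) svec" where
  "kron_vec a b = (\<chi> p. a $ fst p * b $ snd p)"

definition kron_mat :: "real ^ 'N ^ 'N \<Rightarrow> real ^ 'n ^ 'n \<Rightarrow> ('N::finite, 'n::finite) smat" where
  "kron_mat A B = (\<chi> p q. A $ fst p $ fst q * B $ snd p $ snd q)"

definition agent_diag :: "('N \<Rightarrow> real) \<Rightarrow> ('N::finite, 'n::finite) smat" where
  "agent_diag c = (\<chi> p q. if p = q then c (fst p) else 0)"

definition col2 :: "real ^ 'a \<Rightarrow> real ^ 'b \<Rightarrow> real ^ ('a::finite + 'b::finite)" where
  "col2 x y = (\<chi> r. case r of Inl p \<Rightarrow> x $ p | Inr q \<Rightarrow> y $ q)"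

definition block2 ::
  "real ^ 'a ^ 'a \<Rightarrow> real ^ 'b ^ 'a \<Rightarrow> real ^ 'a ^ 'b \<Rightarrow> real ^ 'b ^ 'b
    \<Rightarrow> real ^ ('a::finite + 'b::finite) ^ ('a + 'b)" where
  "block2 A B C D = (\<chi> r s. case r of
      Inl p \<Rightarrow> (case s of Inl p' \<Rightarrow> A $ p $ p' | Inr q' \<Rightarrow> B $ p $ q')
    | Inr q \<Rightarrow> (case s of Inl p' \<Rightarrow> C $ q $ p' | Inr q' \<Rightarrow> D $ q $ q'))"

definition pos_semidef :: "real ^ 'a ^ 'a \<Rightarrow> bool" where
  "pos_semidef A \<longleftrightarrow> transpose A = A \<and> (\<forall>x. 0 \<le> x \<bullet> (A *v x))"

text \<open>Well defined whenever \<open>A\<close> itself is symmetric positive semidefinite.\<close>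

definition psd_sqrt :: "real ^ 'a ^ 'a \<Rightarrow> real ^ 'a ^ 'a" where
  "psd_sqrt A = (THE S. pos_semidef S \<and> S ** S = A)"

definition sqnorm_mat :: "real ^ 'a ^ 'a \<Rightarrow> real ^ 'a \<Rightarrow> real" where
  "sqnorm_mat H z = z \<bullet> (H *v z)"

definition gradient :: "('a::real_inner \<Rightarrow> real) \<Rightarrow> 'a \<Rightarrow> 'a" where
  "gradient f x = (THE D. GDERIV f x :> D)"

definition smooth_fun :: "real \<Rightarrow> ('a::real_inner \<Rightarrow> real) \<Rightarrow> bool" where
  "smooth_fun L f \<longleftrightarrow> (\<forall>x. f differentiable (at x)) \<and> L-lipschitz_on UNIV (gradient f)"

definition ereal_epigraph :: "('a \<Rightarrow> ereal) \<Rightarrow> ('a \<times> real) set" where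
  "ereal_epigraph g = {(x, r). g x \<le> ereal r}"

definition proper_closed_convex :: "('a::real_normed_vector \<Rightarrow> ereal) \<Rightarrow> bool" where
  "proper_closed_convex g \<longleftrightarrow>
     (\<forall>x. g x \<noteq> -\<infinity>) \<and> (\<exists>x. g x \<noteq> \<infinity>) \<and>
     closed (ereal_epigraph g) \<and> convex (ereal_epigraph g)"

definition prox :: "real ^ 'a ^ 'a \<Rightarrow> (real ^ 'a \<Rightarrow> ereal) \<Rightarrow> real ^ 'a \<Rightarrow> real ^ 'a" where
  "prox H \<theta> x = arg_min (\<lambda>y. \<theta> y + ereal (1/2 * sqnorm_mat H (y - x))) (\<lambda>_. True)"

definition undirected_connected :: "('N \<times> 'N) set \<Rightarrow> bool" where
  "undirected_connected E \<longleftrightarrow> sym E \<and> (\<forall>i j. (i, j) \<in> E\<^sup>*)"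

definition doubly_stochastic :: "real ^ 'N ^ 'N \<Rightarrow> bool" where
  "doubly_stochastic W \<longleftrightarrow>
     (\<forall>i j. 0 \<le> W $ i $ j) \<and> (\<forall>i. (\<Sum>j\<in>UNIV. W $ i $ j) = 1) \<and> (\<forall>j. (\<Sum>i\<in>UNIV. W $ i $ j) = 1)"

definition mixing_matrix :: "('N \<times> 'N) set \<Rightarrow> real ^ 'N ^ 'N \<Rightarrow> bool" where
  "mixing_matrix E W \<longleftrightarrow>
     transpose W = W \<and> doubly_stochastic W \<and>
     {v. (mat 1 - W) *v v = 0} = span {\<chi> i. 1} \<and>
     (\<forall>i j. if (i, j) \<notin> E \<and> i \<noteq> j then W $ i $ j = 0 else W $ i $ j > 0)"

definition V_mat :: "real ^ 'N ^ 'N \<Rightarrow> ('N::finite, 'n::finite) smat" where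
  "V_mat W = psd_sqrt (mat 1 - kron_mat W (mat 1))"

definition F_sum :: "('N \<Rightarrow> real ^ 'n \<Rightarrow> real) \<Rightarrow> ('N::finite, 'n::finite) svec \<Rightarrow> real" where
  "F_sum f x = (\<Sum>i\<in>UNIV. f i (agent x i))"

definition G_sum :: "('N \<Rightarrow> real ^ 'n \<Rightarrow> ereal) \<Rightarrow> ('N::finite, 'n::finite) svec \<Rightarrow> ereal" where
  "G_sum g x = (\<Sum>i\<in>UNIV. g i (agent x i))"

definition objective ::
  "('N::finite \<Rightarrow> real ^ 'n \<Rightarrow> real) \<Rightarrow> ('N \<Rightarrow> real ^ 'n \<Rightarrow> ereal) \<Rightarrow> real ^ 'n \<Rightarrow> ereal" where
  "objective f g x = (\<Sum>i\<in>UNIV. ereal (f i x) + g i x)"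

text \<open>A solution has finite objective value; without this clause every point would be a
  solution when the domains of the \<open>g i\<close> have no common point.\<close>

definition optimal ::
  "('N::finite \<Rightarrow> real ^ 'n \<Rightarrow> real) \<Rightarrow> ('N \<Rightarrow> real ^ 'n \<Rightarrow> ereal) \<Rightarrow> real ^ 'n \<Rightarrow> bool" where
  "optimal f g x \<longleftrightarrow> objective f g x < \<infinity> \<and> (\<forall>y. objective f g x \<le> objective f g y)"

definition lagrangian ::
  "('N::finite \<Rightarrow> real ^ 'n::finite \<Rightarrow> real) \<Rightarrow> ('N \<Rightarrow> real ^ 'n \<Rightarrow> ereal) \<Rightarrow> real ^ 'N ^ 'N
    \<Rightarrow> ('N, 'n) svec \<Rightarrow> ('N, 'n) svec \<Rightarrow> ereal" where
  "lagrangian f g W x \<alpha> = ereal (F_sum f x) + G_sum g x - ereal (\<alpha> \<bullet> (V_mat W *v x))"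

definition saddle_points ::
  "('N::finite \<Rightarrow> real ^ 'n::finite \<Rightarrow> real) \<Rightarrow> ('N \<Rightarrow> real ^ 'n \<Rightarrow> ereal) \<Rightarrow> real ^ 'N ^ 'N
    \<Rightarrow> (('N, 'n) svec \<times> ('N, 'n) svec) set" where
  "saddle_points f g W = {(xs, \<alpha>s). \<forall>x \<alpha>.
      lagrangian f g W xs \<alpha> \<le> lagrangian f g W xs \<alpha>s \<and>
      lagrangian f g W xs \<alpha>s \<le> lagrangian f g W x \<alpha>s}"

definition Q_mat :: "('N \<Rightarrow> real) \<Rightarrow> real \<Rightarrow> real ^ 'N ^ 'N \<Rightarrow> ('N::finite, 'n::finite) bmat" where
  "Q_mat \<tau> \<beta> W = block2 (matrix_inv (agent_diag \<tau>)) (V_mat W) 0 ((1 / \<beta>) *\<^sub>R mat 1)"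

definition M_mat :: "('N \<Rightarrow> real) \<Rightarrow> real ^ 'N ^ 'N \<Rightarrow> ('N::finite, 'n::finite) bmat" where
  "M_mat \<tau> W = block2 (mat 1) (agent_diag \<tau> ** V_mat W) 0 (mat 1)"

definition H_mat :: "('N \<Rightarrow> real) \<Rightarrow> real \<Rightarrow> real ^ 'N ^ 'N \<Rightarrow> ('N::finite, 'n::finite) bmat" where
  "H_mat \<tau> \<beta> W = Q_mat \<tau> \<beta> W ** matrix_inv (M_mat \<tau> W)"

definition G_mat :: "('N \<Rightarrow> real) \<Rightarrow> real \<Rightarrow> real ^ 'N ^ 'N \<Rightarrow> ('N::finite, 'n::finite) bmat" where
  "G_mat \<tau> \<beta> W = transpose (Q_mat \<tau> \<beta> W) + Q_mat \<tau> \<beta> W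
     - transpose (M_mat \<tau> W) ** H_mat \<tau> \<beta> W ** M_mat \<tau> W"

definition H1_mat ::
  "('N \<Rightarrow> real) \<Rightarrow> ('N \<Rightarrow> real) \<Rightarrow> real \<Rightarrow> real ^ 'N ^ 'N \<Rightarrow> ('N::finite, 'n::finite) bmat" where
  "H1_mat L \<tau> \<beta> W = G_mat \<tau> \<beta> W - (1/2) *\<^sub>R block2 (agent_diag L) 0 0 0"

definition D_iPGM ::
  "('N::finite \<Rightarrow> real ^ 'n::finite \<Rightarrow> real) \<Rightarrow> ('N \<Rightarrow> real ^ 'n \<Rightarrow> ereal)
    \<Rightarrow> real ^ 'N ^ 'N \<Rightarrow> ('N \<Rightarrow> real) \<Rightarrow> real \<Rightarrow> (nat \<Rightarrow> ('N, 'n) svec)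
    \<Rightarrow> (nat \<Rightarrow> ('N, 'n) svec) \<Rightarrow> (nat \<Rightarrow> ('N, 'n) svec)
    \<Rightarrow> (nat \<Rightarrow> ('N, 'n) svec) \<Rightarrow> (nat \<Rightarrow> ('N, 'n) svec) \<Rightarrow> bool" where
  "D_iPGM f g W \<tau> \<beta> d x \<alpha> xt \<alpha>t \<longleftrightarrow>
     \<alpha> 0 = 0 \<and>
     (\<forall>k. xt k = prox (matrix_inv (agent_diag \<tau>)) (G_sum g)
             (x k - agent_diag \<tau> *v (gradient (F_sum f) (x k) - V_mat W *v \<alpha> k - d k)) \<and>
          \<alpha>t k = \<alpha> k - \<beta> *\<^sub>R (V_mat W *v xt k) \<and>
          col2 (x (Suc k)) (\<alpha> (Suc k))
            = col2 (x k) (\<alpha> k) - M_mat \<tau> W *v (col2 (x k) (\<alpha> k) - col2 (xt k) (\<alpha>t k)))"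

end

theory Submission
  imports Defs
begin

text \<open>
  Multiplying out the block matrices gives \<open>H = diag(1/\<Gamma>, I/\<beta>)\<close> and
  \<open>H\<^sub>1 = diag(1/\<Gamma> - L\<^sub>F/2, I/\<beta> - V \<Gamma> V)\<close>; both are positive definite because
  \<open>V\<^sup>2 = I - W\<close> lies strictly below \<open>2 I\<close>. Saddle points are the consensual points satisfying
  one subgradient inequality per agent, and the proximal step yields a subgradient inequality at
  \<open>xt k\<close>. Adding the two and bounding the gradient term by cocoercivity gives the descent
  inequality. Absorbing the error term into the \<open>H\<^sub>1\<close> norm of the residual leaves
  \<open>a (k + 1) \<le> a k + K \<epsilon> k\<close> for the \<open>H\<close> distance \<open>a k\<close> to any saddle point: these distances
  converge and the residuals vanish. Every cluster point is then a saddle point by closedness of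
  the epigraphs, and the distance to such a cluster point tends to zero.
\<close>

section \<open>Square roots of positive semidefinite matrices\<close>

text \<open>Two objects of the statement are given by description or choice: the square root behind
  \<open>V_mat\<close> and the minimizer behind \<open>prox\<close>. Nothing can be said of either
  before existence is shown, hence the spectral theory and the coercivity argument. Existence of
  proximal points rests on an affine minorant of each \<open>g i\<close>. The subgradient inequality
  at a saddle point supplies one, without separation theorems; this is why facts about the iterates
  carry a reference saddle point. The gradient is taken at \<open>x k\<close>, but the proximal
  inequality holds at \<open>xt k\<close>. This mismatch costs L/4 times the squared residual per
  agent; doubled, it is the L/2 subtracted in \<open>H1_mat\<close>, and \<tau> < 2/L keeps the
  difference positive. The error term grows with the distance to the saddle point, and it must be
  estimated before boundedness is known. The recursion is therefore passed from squared distances to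
  distances: the growing factor becomes the cross term of a square, and only a multiple of
  \<epsilon> remains.\<close>

lemma symmetric_matrix_inner:
  fixes A :: "real ^ 'a ^ 'a"
  assumes "transpose A = A"
  shows "x \<bullet> (A *v y) = (A *v x) \<bullet> y"
  using dot_lmul_matrix[of x A y] transpose_matrix_vector[of A x] assms by simp

text \<open>First-order optimality in scalar form: for small t of sign opposite to a, the linear
  term outweighs the quadratic one. Dividing by |b| + 1 makes t small enough for every b.\<close>

lemma quadratic_nonneg_imp_linear_coeff_zero:
  fixes a b :: real
  assumes "\<And>t. 0 \<le> a * t + b * t\<^sup>2"
  shows "a = 0"
proof (rule ccontr)
  assume "a \<noteq> 0"
  define c where "c = \<bar>b\<bar> + 1"
  have c: "c > 0" "b < c" by (auto simp: c_def)
  have "a * (- a / c) + b * (- a / c)\<^sup>2 = a\<^sup>2 / c * (b / c - 1)"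
    using c by (simp add: field_simps power2_eq_square)
  also have "\<dots> < 0"
    using c \<open>a \<noteq> 0\<close> by (intro mult_pos_neg) (auto simp: field_simps)
  finally show False using assms[of "- a / c"] by simp
qed

text \<open>A maximizer v of the Rayleigh quotient on the unit sphere of U is an eigenvector: with c
  the maximum, the form c |y|^2 - y.Ay is nonnegative on U and vanishes at v, so its derivative at v
  vanishes along U. The invariant subspace is there so that the lemma applies to orthogonal
  complements of eigenvectors already found.\<close>

lemma symmetric_matrix_eigenvector_in_subspace:
  fixes A :: "real ^ 'a ^ 'a"
  assumes sym: "transpose A = A" and U: "subspace U" "U \<noteq> {0}"
    and inv: "\<And>x. x \<in> U \<Longrightarrow> A *v x \<in> U"
  obtains v c where "v \<in> U" "norm v = 1" "A *v v = c *\<^sub>R v"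
proof -
  let ?S = "sphere 0 1 \<inter> U"
  obtain u where u: "u \<in> U" "u \<noteq> 0" using U subspace_0 by blast
  have "u /\<^sub>R norm u \<in> ?S" using u U by (auto simp: subspace_scale)
  moreover have "compact ?S"
    using closed_subspace[OF U(1)] compact_sphere by (intro compact_Int_closed)
  moreover have "continuous_on ?S (\<lambda>x. x \<bullet> (A *v x))"
    by (intro continuous_intros matrix_vector_mult_linear_continuous_on)
  ultimately obtain v where v: "v \<in> ?S" and max: "\<And>y. y \<in> ?S \<Longrightarrow> y \<bullet> (A *v y) \<le> v \<bullet> (A *v v)"
    using continuous_attains_sup[of ?S "\<lambda>x. x \<bullet> (A *v x)"] by blast
  define c where "c = v \<bullet> (A *v v)"
  have q: "0 \<le> c * (y \<bullet> y) - y \<bullet> (A *v y)" if "y \<in> U" for y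
  proof (cases "y = 0")
    case False
    have "y /\<^sub>R norm y \<in> ?S" using False that U by (auto simp: subspace_scale)
    from max[OF this] have "inverse (norm y) * (inverse (norm y) * (y \<bullet> (A *v y))) \<le> c"
      by (simp add: c_def matrix_vector_mult_scaleR)
    then show ?thesis using False
      by (simp add: field_simps dot_square_norm power2_eq_square)
  qed auto
  \<comment> \<open>The residual of the eigenvalue equation serves as its own test direction: by
    invariance it lies in U, and moving v along it gives the linear coefficient 2 |w|^2.\<close>
  define w where "w = c *\<^sub>R v - A *v v"
  have wU: "w \<in> U" using v U inv by (auto simp: w_def subspace_diff subspace_scale)
  have vv: "v \<bullet> v = 1" using v by (simp add: dot_square_norm)
  have "0 \<le> 2 * (w \<bullet> w) * t + (c * (w \<bullet> w) - w \<bullet> (A *v w)) * t\<^sup>2" for t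
  proof -
    have "v + t *\<^sub>R w \<in> U" using v wU U by (auto simp: subspace_add subspace_scale)
    from q[OF this] have "0 \<le> c * ((v + t *\<^sub>R w) \<bullet> (v + t *\<^sub>R w)) - (v + t *\<^sub>R w) \<bullet> (A *v (v + t *\<^sub>R w))" .
    also have "\<dots> = 2 * t * (w \<bullet> (c *\<^sub>R v - A *v v)) + (c * (w \<bullet> w) - w \<bullet> (A *v w)) * t\<^sup>2"
    proof -
      have "v \<bullet> (A *v w) = w \<bullet> (A *v v)" "v \<bullet> w = w \<bullet> v"
        using symmetric_matrix_inner[OF sym, of v w] by (simp_all add: inner_commute)
      then show ?thesis using vv
        by (simp add: inner_add_left inner_add_right inner_diff_right matrix_vector_right_distrib
            matrix_vector_mult_scaleR c_def[symmetric]) (simp add: algebra_simps power2_eq_square)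
    qed
    finally show ?thesis by (fold w_def) (simp add: mult_ac)
  qed
  from quadratic_nonneg_imp_linear_coeff_zero[OF this] have "w = 0" by simp
  with v show ?thesis by (intro that[of v c]) (auto simp: w_def)
qed

text \<open>An orthonormal set of eigenvectors of largest cardinality must span: otherwise its
  orthogonal complement is a nonzero invariant subspace and contains one more eigenvector.
  Orthonormal sets are independent, so the dimension bounds the cardinality and the maximum
  exists.\<close>

lemma symmetric_matrix_orthonormal_eigenbasis:
  fixes A :: "real ^ 'a ^ 'a"
  assumes sym: "transpose A = A"
  obtains B where "finite B" "pairwise orthogonal B" "\<And>b. b \<in> B \<Longrightarrow> norm b = 1"
    "\<And>b. b \<in> B \<Longrightarrow> A *v b = (b \<bullet> (A *v b)) *\<^sub>R b" "span B = UNIV"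
proof -
  define P where "P B \<longleftrightarrow> pairwise orthogonal B \<and> (\<forall>b\<in>B. norm b = 1) \<and> (\<forall>b\<in>B. \<exists>c. A *v b = c *\<^sub>R b)"
    for B :: "(real ^ 'a) set"
  have ind: "independent B" if "P B" for B
    using that by (intro pairwise_orthogonal_independent) (auto simp: P_def)
  then have card: "card B \<le> DIM(real ^ 'a)" "finite B" if "P B" for B
    using that independent_card_le independent_imp_finite by blast+
  have "P {}" by (auto simp: P_def)
  define B where "B = (ARG_MAX card B. P B)"
  have "P B \<and> (\<forall>C. P C \<longrightarrow> card C \<le> card B)" unfolding B_def
    using \<open>P {}\<close> card by (intro arg_max_nat_lemma[of P "{}" card "Suc (DIM(real ^ 'a))"]) (auto simp: le_imp_less_Suc)
  then have B: "P B" and max: "\<And>C. P C \<Longrightarrow> card C \<le> card B" by auto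
  have "span B = UNIV"
  proof (rule ccontr)
    assume "span B \<noteq> UNIV"
    define U where "U = {y. \<forall>b\<in>B. b \<bullet> y = 0}"
    have U: "subspace U" by (auto simp: U_def subspace_def inner_add_right)
    obtain u where "u \<noteq> 0" "\<forall>x\<in>span B. u \<bullet> x = 0"
      using span_not_UNIV_orthogonal[OF \<open>span B \<noteq> UNIV\<close>] by auto
    then have "u \<in> U" by (auto simp: U_def inner_commute span_base)
    have "A *v x \<in> U" if "x \<in> U" for x
      using that B symmetric_matrix_inner[OF sym, of _ x] by (fastforce simp: U_def P_def)
    then obtain v c where v: "v \<in> U" "norm v = 1" "A *v v = c *\<^sub>R v"
      using symmetric_matrix_eigenvector_in_subspace[OF sym U] \<open>u \<in> U\<close> \<open>u \<noteq> 0\<close> by blast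
    have "v \<notin> B" using v by (auto simp: U_def)
    have "P (insert v B)" using B v
      by (auto simp: P_def pairwise_insert U_def orthogonal_def inner_commute)
    from max[OF this] \<open>v \<notin> B\<close> card(2)[OF B] show False by simp
  qed
  moreover have "A *v b = (b \<bullet> (A *v b)) *\<^sub>R b" if "b \<in> B" for b
    using that B by (auto simp: P_def dot_square_norm)
  ultimately show ?thesis using that[of B] card(2)[OF B] B by (auto simp: P_def)
qed

text \<open>On an orthonormal eigenbasis the eigenvalues are replaced by their square roots. The
  resulting bilinear form is a sum of symmetric rank-one terms with nonnegative weights, which gives
  symmetry and positivity.\<close>

lemma pos_semidef_sqrt_exists:
  assumes "pos_semidef (A :: real ^ 'a ^ 'a)"
  shows "\<exists>S. pos_semidef S \<and> S ** S = A"
proof -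
  have sym: "transpose A = A" and pos: "\<And>x. 0 \<le> x \<bullet> (A *v x)"
    using assms by (auto simp: pos_semidef_def)
  obtain B where B: "finite B" "pairwise orthogonal B" "\<And>b. b \<in> B \<Longrightarrow> norm b = 1"
    and eig: "\<And>b. b \<in> B \<Longrightarrow> A *v b = (b \<bullet> (A *v b)) *\<^sub>R b" and UNIV: "span B = UNIV"
    using symmetric_matrix_orthonormal_eigenbasis[OF sym] by metis
  define l where "l b = sqrt (b \<bullet> (A *v b))" for b
  define s where "s x = (\<Sum>b\<in>B. (l b * (b \<bullet> x)) *\<^sub>R b)" for x
  have lin: "linear s" unfolding s_def
    by (intro linear_compose_sum ballI linearI)
       (auto simp: inner_add_right algebra_simps)
  have sv: "matrix s *v x = s x" for x using lin by (simp add: matrix_works)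
  have inner: "y \<bullet> s x = (\<Sum>b\<in>B. l b * (b \<bullet> x) * (b \<bullet> y))" for x y
    unfolding s_def inner_sum_right by (simp add: inner_commute mult.assoc)
  have "transpose (matrix s) = matrix s"
  proof -
    have "x \<bullet> (transpose (matrix s) *v y) = x \<bullet> (matrix s *v y)" for x y
    proof -
      have "x \<bullet> (transpose (matrix s) *v y) = y \<bullet> s x"
        using dot_lmul_matrix[of y "matrix s" x] by (simp add: inner_commute sv)
      then show ?thesis by (simp add: sv inner mult_ac)
    qed
    then show ?thesis unfolding matrix_eq by (metis vector_eq_ldot)
  qed
  moreover have "0 \<le> x \<bullet> (matrix s *v x)" for x
    unfolding sv inner using pos by (intro sum_nonneg) (simp add: l_def mult.assoc)
  moreover have "matrix s ** matrix s = A"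
  proof -
    have sb: "s b = l b *\<^sub>R b" if "b \<in> B" for b
    proof -
      have "s b = (\<Sum>a\<in>B. if a = b then l b *\<^sub>R b else 0)" unfolding s_def
        using B that by (intro sum.cong) (auto simp: pairwise_def orthogonal_def dot_square_norm)
      then show ?thesis using B that by simp
    qed
    have "s (s x) = A *v x" for x
    proof (rule linear_eq_on_span[of "\<lambda>x. s (s x)" "(*v) A" B])
      show "linear (\<lambda>x. s (s x))" using linear_compose[OF lin lin] by (simp add: o_def)
      show "s (s b) = A *v b" if "b \<in> B" for b
        using sb[OF that] eig[OF that] pos[of b] by (simp add: linear_cmul[OF lin] l_def)
    qed (auto simp: UNIV)
    then have "matrix s *v (matrix s *v x) = A *v x" for x by (simp add: sv)
    then have "matrix s ** matrix s *v x = A *v x" for x by (simp only: matrix_vector_mul_assoc)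
    then show ?thesis unfolding matrix_eq by blast
  qed
  ultimately show ?thesis by (auto simp: pos_semidef_def)
qed

text \<open>Let T b = t b. Then S^2 b = t^2 b, so w = S b - t b satisfies S w = -t w. If t > 0,
  positivity of S forces w = 0; if t = 0, then |S b|^2 = b.S^2 b = 0. Hence S and T agree on an
  eigenbasis of T.\<close>

lemma pos_semidef_sqrt_unique:
  fixes S T :: "real ^ 'a ^ 'a"
  assumes S: "pos_semidef S" and T: "pos_semidef T" and eq: "S ** S = T ** T"
  shows "S = T"
proof -
  have symS: "transpose S = S" and symT: "transpose T = T"
    using S T by (simp_all add: pos_semidef_def)
  have posS: "0 \<le> x \<bullet> (S *v x)" and posT: "0 \<le> x \<bullet> (T *v x)" for x
    using S T by (auto simp: pos_semidef_def)
  obtain B where eig: "\<And>b. b \<in> B \<Longrightarrow> T *v b = (b \<bullet> (T *v b)) *\<^sub>R b" and UNIV: "span B = UNIV"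
    using symmetric_matrix_orthonormal_eigenbasis[OF symT] by metis
  have ST: "S *v b = T *v b" if "b \<in> B" for b
  proof -
    define t where "t = b \<bullet> (T *v b)"
    have Tb: "T *v b = t *\<^sub>R b" using eig[OF that] by (simp add: t_def)
    have "S *v (S *v b) = T *v (T *v b)" using eq by (simp add: matrix_vector_mul_assoc)
    then have SS: "S *v (S *v b) = t\<^sup>2 *\<^sub>R b"
      by (simp add: Tb matrix_vector_mult_scaleR power2_eq_square)
    have t0: "t \<ge> 0" using posT by (simp add: t_def)
    define w where "w = S *v b - t *\<^sub>R b"
    have "w = 0"
    proof (cases "t = 0")
      case True
      then have "(S *v b) \<bullet> (S *v b) = 0"
        using SS symmetric_matrix_inner[OF symS, of b "S *v b"] by simp
      then show ?thesis using True by (simp add: w_def)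
    next
      case False
      have "S *v w = - t *\<^sub>R w"
        by (simp add: w_def matrix_vector_mult_diff_distrib matrix_vector_mult_scaleR SS
            scaleR_diff_right power2_eq_square)
      then have "- t * (w \<bullet> w) \<ge> 0" using posS[of w] by simp
      then have "w \<bullet> w \<le> 0" using False t0 by (simp add: mult_le_0_iff)
      then show ?thesis by (meson inner_gt_zero_iff linorder_not_less)
    qed
    then show ?thesis by (simp add: w_def Tb)
  qed
  have "S *v x = T *v x" for x
    by (rule linear_eq_on_span[of "(*v) S" "(*v) T" B]) (simp_all add: UNIV ST)
  then show ?thesis unfolding matrix_eq by blast
qed

lemma psd_sqrt:
  assumes "pos_semidef A"
  shows "pos_semidef (psd_sqrt A)" "psd_sqrt A ** psd_sqrt A = A"
proof -
  have "\<exists>!S. pos_semidef S \<and> S ** S = A"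
    using pos_semidef_sqrt_exists[OF assms] pos_semidef_sqrt_unique by metis
  from theI'[OF this] show "pos_semidef (psd_sqrt A)" "psd_sqrt A ** psd_sqrt A = A"
    by (auto simp: psd_sqrt_def)
qed

section \<open>Smooth convex functions and proximal minimizers\<close>

lemma GDERIV_unique:
  assumes "GDERIV f x :> D" "GDERIV f x :> D'"
  shows "D = D'"
proof -
  have "(\<lambda>h. h \<bullet> D) = (\<lambda>h. h \<bullet> D')"
    using assms unfolding gderiv_def by (rule has_derivative_unique)
  then show ?thesis by (metis vector_eq_ldot)
qed

lemma gradient_eqI: "GDERIV f x :> D \<Longrightarrow> gradient f x = D"
  unfolding gradient_def by (rule the_equality) (auto intro: GDERIV_unique)

lemma GDERIV_gradient:
  fixes f :: "'a::euclidean_space \<Rightarrow> real"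
  assumes "f differentiable (at x)"
  shows "GDERIV f x :> gradient f x"
proof -
  obtain f' where f': "(f has_derivative f') (at x)" using assms by (auto simp: differentiable_def)
  then have lin: "linear f'" by (rule has_derivative_linear)
  have "f' = (\<lambda>h. h \<bullet> (\<Sum>b\<in>Basis. f' b *\<^sub>R b))"
  proof
    fix h
    have "f' h = f' (\<Sum>b\<in>Basis. (h \<bullet> b) *\<^sub>R b)" by (simp add: euclidean_representation)
    also have "\<dots> = h \<bullet> (\<Sum>b\<in>Basis. f' b *\<^sub>R b)"
      by (simp add: linear_sum[OF lin] linear_cmul[OF lin] inner_sum_right mult.commute)
    finally show "f' h = h \<bullet> (\<Sum>b\<in>Basis. f' b *\<^sub>R b)" .
  qed
  with f' have "GDERIV f x :> (\<Sum>b\<in>Basis. f' b *\<^sub>R b)" by (simp add: gderiv_def)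
  then show ?thesis using gradient_eqI by metis
qed

lemma GDERIV_along_line:
  assumes "GDERIV f (x + t *\<^sub>R v) :> D"
  shows "((\<lambda>s. f (x + s *\<^sub>R v)) has_real_derivative v \<bullet> D) (at t)"
proof -
  have f: "(f has_derivative (\<lambda>h. h \<bullet> D)) (at (x + t *\<^sub>R v))" using assms by (simp add: gderiv_def)
  have "((\<lambda>s. x + s *\<^sub>R v) has_derivative (\<lambda>h. h *\<^sub>R v)) (at t)"
    by (auto intro!: derivative_eq_intros)
  from has_derivative_compose[OF this f] show ?thesis
    by (simp add: has_field_derivative_def mult_commute_abs)
qed

lemma convex_on_GDERIV_above_tangent:
  assumes "convex_on UNIV f" "GDERIV f x :> D"
  shows "f x + (y - x) \<bullet> D \<le> f y"
proof -
  let ?p = "\<lambda>s. f (x + s *\<^sub>R (y - x))"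
  have "convex_on UNIV ?p"
  proof (rule convex_onI)
    fix t s r :: real assume t: "0 < t" "t < 1"
    have "x + ((1 - t) *\<^sub>R s + t *\<^sub>R r) *\<^sub>R (y - x)
      = (1 - t) *\<^sub>R (x + s *\<^sub>R (y - x)) + t *\<^sub>R (x + r *\<^sub>R (y - x))"
      by (simp add: algebra_simps)
    then show "?p ((1 - t) *\<^sub>R s + t *\<^sub>R r) \<le> (1 - t) * ?p s + t * ?p r"
      using convex_onD[OF assms(1), of t] t by simp
  qed simp
  moreover have "(?p has_real_derivative (y - x) \<bullet> D) (at 0)"
    using assms by (intro GDERIV_along_line) simp
  ultimately have "((y - x) \<bullet> D) * (1 - 0) \<le> ?p 1 - ?p 0"
    by (intro convex_on_imp_above_tangent[of UNIV]) auto
  then show ?thesis by simp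
qed

lemma smooth_fun_GDERIV:
  fixes f :: "'a::euclidean_space \<Rightarrow> real"
  shows "smooth_fun L f \<Longrightarrow> GDERIV f x :> gradient f x"
  by (auto simp: smooth_fun_def intro: GDERIV_gradient)

lemma smooth_fun_gradient_Lipschitz:
  "smooth_fun L f \<Longrightarrow> norm (gradient f x - gradient f y) \<le> L * norm (x - y)"
  using lipschitz_onD[of L UNIV "gradient f" x y] by (simp add: smooth_fun_def dist_norm)

lemma descent_lemma:
  fixes f :: "'a::euclidean_space \<Rightarrow> real"
  assumes f: "smooth_fun L f"
  shows "f y \<le> f x + (y - x) \<bullet> gradient f x + L / 2 * (norm (y - x))\<^sup>2"
proof -
  define v where "v = y - x"
  \<comment> \<open>Difference between f on the segment and its quadratic upper model, up to a
    constant. A sign of its derivative replaces the usual integral of the gradient.\<close>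
  define p where "p t = f (x + t *\<^sub>R v) - t * (v \<bullet> gradient f x) - L / 2 * t\<^sup>2 * (norm v)\<^sup>2" for t
  have "p 1 \<le> p 0"
  proof (rule DERIV_nonpos_imp_nonincreasing[of 0 1 p])
    fix t :: real assume t: "0 \<le> t" "t \<le> 1"
    let ?d = "v \<bullet> gradient f (x + t *\<^sub>R v) - v \<bullet> gradient f x - L * t * (norm v)\<^sup>2"
    have "(p has_real_derivative ?d) (at t)" unfolding p_def
      by (rule derivative_eq_intros GDERIV_along_line smooth_fun_GDERIV[OF f] refl | simp)+
    moreover have "?d \<le> 0"
    proof -
      have "v \<bullet> gradient f (x + t *\<^sub>R v) - v \<bullet> gradient f x
          \<le> norm v * norm (gradient f (x + t *\<^sub>R v) - gradient f x)"
        using norm_cauchy_schwarz[of v "gradient f (x + t *\<^sub>R v) - gradient f x"]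
        by (simp add: inner_diff_right)
      also have "\<dots> \<le> norm v * (L * norm (x + t *\<^sub>R v - x))"
        by (intro mult_left_mono smooth_fun_gradient_Lipschitz f) simp
      also have "\<dots> = L * t * (norm v)\<^sup>2" using t by (simp add: power2_eq_square)
      finally show ?thesis by simp
    qed
    ultimately show "\<exists>d. (p has_real_derivative d) (at t) \<and> d \<le> 0" by blast
  qed simp
  then show ?thesis by (simp add: p_def v_def)
qed

text \<open>Subtracting the tangent at x turns x into a minimizer. A gradient step of length 1/L
  from y for the shifted function, ending at z, cannot go below the value at x, while the descent
  lemma guarantees a decrease of |D|^2 / (2 L).\<close>

lemma smooth_convex_gradient_gap:
  fixes f :: "'a::euclidean_space \<Rightarrow> real"
  assumes f: "smooth_fun L f" "convex_on UNIV f" and L: "L > 0"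
  shows "f x + (y - x) \<bullet> gradient f x + (norm (gradient f y - gradient f x))\<^sup>2 / (2 * L) \<le> f y"
proof -
  define D where "D = gradient f y - gradient f x"
  define z where "z = y - (1 / L) *\<^sub>R D"
  have "f x + (z - x) \<bullet> gradient f x \<le> f z"
    by (intro convex_on_GDERIV_above_tangent smooth_fun_GDERIV[OF f(1)] f)
  also have "\<dots> \<le> f y + (z - y) \<bullet> gradient f y + L / 2 * (norm (z - y))\<^sup>2"
    by (rule descent_lemma[OF f(1)])
  finally have "f x + (z - x) \<bullet> gradient f x - (z - y) \<bullet> gradient f y - L / 2 * (norm (z - y))\<^sup>2 \<le> f y"
    by simp
  moreover have "(z - x) \<bullet> gradient f x = (y - x) \<bullet> gradient f x - (D \<bullet> gradient f x) / L"
    by (simp add: z_def inner_diff_left)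
  moreover have "(z - y) \<bullet> gradient f y = - (D \<bullet> gradient f y) / L"
    by (simp add: z_def inner_diff_left)
  moreover have "L / 2 * (norm (z - y))\<^sup>2 = (norm D)\<^sup>2 / (2 * L)"
    using L by (simp add: z_def power_divide power2_eq_square)
  moreover have "(D \<bullet> gradient f y) / L - (D \<bullet> gradient f x) / L = (norm D)\<^sup>2 / L"
    by (simp add: D_def power2_norm_eq_inner inner_diff_right diff_divide_distrib)
  moreover have "(norm D)\<^sup>2 / L = 2 * ((norm D)\<^sup>2 / (2 * L))" using L by simp
  ultimately show ?thesis by (fold D_def) linarith
qed

text \<open>The Baillon-Haddad inequality: the sum of the gap inequality with its copy in which x
  and y are exchanged.\<close>

lemma gradient_cocoercive:
  fixes f :: "'a::euclidean_space \<Rightarrow> real"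
  assumes "smooth_fun L f" "convex_on UNIV f" and L: "L > 0"
  shows "(norm (gradient f x - gradient f y))\<^sup>2 / L \<le> (gradient f x - gradient f y) \<bullet> (x - y)"
proof -
  have "(norm (gradient f x - gradient f y))\<^sup>2 / L
    = 2 * ((norm (gradient f x - gradient f y))\<^sup>2 / (2 * L))" using L by simp
  then show ?thesis
    using smooth_convex_gradient_gap[OF assms, of x y] smooth_convex_gradient_gap[OF assms, of y x]
    by (simp add: inner_diff_left inner_diff_right inner_commute norm_minus_commute)
qed

text \<open>The gradient is known at x but is paired with a displacement from t. Splitting t - y =
  (x - y) - (x - t), cocoercivity yields |D|^2 / L, and completing the square against D.(x - t)
  leaves exactly the factor L/4.\<close>

lemma gradient_three_point:
  fixes f :: "'a::euclidean_space \<Rightarrow> real"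
  assumes "smooth_fun L f" "convex_on UNIV f" and L: "L > 0"
  shows "- (L / 4 * (norm (x - t))\<^sup>2) \<le> (gradient f x - gradient f y) \<bullet> (t - y)"
proof -
  define D where "D = gradient f x - gradient f y"
  define u where "u = x - t"
  have "0 \<le> ((1 / L) *\<^sub>R D - (1 / 2) *\<^sub>R u) \<bullet> ((1 / L) *\<^sub>R D - (1 / 2) *\<^sub>R u) * L"
    using L by simp
  also have "\<dots> = (D \<bullet> D) / L - D \<bullet> u + L / 4 * (u \<bullet> u)"
    using L by (simp add: inner_diff_left inner_diff_right inner_commute[of u D]) (simp add: field_simps)
  also have "\<dots> = (norm D)\<^sup>2 / L - D \<bullet> (x - t) + L / 4 * (norm (x - t))\<^sup>2"
    by (simp add: u_def power2_norm_eq_inner)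
  also have "(norm D)\<^sup>2 / L \<le> D \<bullet> (x - y)"
    unfolding D_def by (rule gradient_cocoercive[OF assms])
  finally show ?thesis by (simp add: D_def[symmetric] inner_diff_right)
qed

section \<open>Subgradient inequalities and existence of proximal points\<close>

text \<open>On the segment from z to w the epigraph bounds g by linear interpolation, so g + h is
  majorized by a differentiable function of t that touches it at t = 0. Minimality at z makes the
  derivative of the majorant at 0 nonnegative, which is the claim.\<close>

lemma convex_smooth_minimum_subgradient:
  fixes g :: "'a::real_inner \<Rightarrow> ereal"
  assumes conv: "convex (ereal_epigraph g)" and proper: "\<And>w. g w \<noteq> -\<infinity>"
    and fin: "g z \<noteq> \<infinity>" and h: "GDERIV h z :> D"
    and min: "\<And>w. g z + ereal (h z) \<le> g w + ereal (h w)"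
  shows "g z + ereal (- ((w - z) \<bullet> D)) \<le> g w"
proof (cases "g w")
  case (real r)
  obtain s where s: "g z = ereal s" using fin proper[of z] by (cases "g z") auto
  \<comment> \<open>With \<open>g z = s\<close> and \<open>g w = r\<close>, the value
    \<open>s + p t\<close> bounds g + h at the point with parameter t, with equality at t =
    0.\<close>
  define p where "p t = h (z + t *\<^sub>R (w - z)) - t * (s - r)" for t
  have der: "(p has_real_derivative (w - z) \<bullet> D - (s - r)) (at 0)" unfolding p_def
    using h by (auto intro!: derivative_eq_intros GDERIV_along_line)
  have "p 0 \<le> p t" if "0 < t" "t \<le> 1" for t
  proof -
    have "(z, s) \<in> ereal_epigraph g" "(w, r) \<in> ereal_epigraph g"
      using s real by (auto simp: ereal_epigraph_def)
    then have "(1 - t) *\<^sub>R (z, s) + t *\<^sub>R (w, r) \<in> ereal_epigraph g"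
      using conv that by (intro convexD) auto
    moreover have "(1 - t) *\<^sub>R z + t *\<^sub>R w = z + t *\<^sub>R (w - z)" by (simp add: algebra_simps)
    ultimately have "g (z + t *\<^sub>R (w - z)) \<le> ereal ((1 - t) * s + t * r)"
      by (simp add: ereal_epigraph_def)
    then have "g (z + t *\<^sub>R (w - z)) + ereal (h (z + t *\<^sub>R (w - z)))
        \<le> ereal ((1 - t) * s + t * r) + ereal (h (z + t *\<^sub>R (w - z)))"
      by (rule add_right_mono)
    from order_trans[OF min this] s show ?thesis by (simp add: p_def algebra_simps)
  qed
  then have "0 \<le> (w - z) \<bullet> D - (s - r)"
  proof -
    have "\<not> (w - z) \<bullet> D - (s - r) < 0"
    proof
      assume "(w - z) \<bullet> D - (s - r) < 0"
      from DERIV_neg_dec_right[OF der this] obtain d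
        where d: "d > 0" "\<And>t. 0 < t \<Longrightarrow> t < d \<Longrightarrow> p t < p 0" by auto
      \<comment> \<open>This parameter lies both in (0, d), where \<open>p\<close> drops below its
        value at 0, and in (0, 1], where interpolation is valid.\<close>
      then have "p (min (d / 2) 1) < p 0" by simp
      moreover have "p 0 \<le> p (min (d / 2) 1)"
        using d \<open>\<And>t. 0 < t \<Longrightarrow> t \<le> 1 \<Longrightarrow> p 0 \<le> p t\<close> by simp
      ultimately show False by simp
    qed
    then show ?thesis by simp
  qed
  then show ?thesis using s real by simp
qed (use proper in auto)

lemma subgradient_imp_convex_smooth_minimum:
  fixes g :: "'a::real_inner \<Rightarrow> ereal"
  assumes h: "convex_on UNIV h" "GDERIV h z :> D"
    and sub: "g z + ereal (- ((w - z) \<bullet> D)) \<le> g w"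
  shows "g z + ereal (h z) \<le> g w + ereal (h w)"
proof -
  have "h z \<le> - ((w - z) \<bullet> D) + h w"
    using convex_on_GDERIV_above_tangent[OF h, of w] by simp
  then have "g z + ereal (h z) \<le> g z + (ereal (- ((w - z) \<bullet> D)) + ereal (h w))"
    by (intro add_left_mono) simp
  also have "\<dots> = (g z + ereal (- ((w - z) \<bullet> D))) + ereal (h w)" by (simp add: add.assoc)
  also have "\<dots> \<le> g w + ereal (h w)" by (rule add_right_mono[OF sub])
  finally show ?thesis .
qed

text \<open>The affine minorant makes every sublevel set of the proximal objective, intersected with
  the epigraph, bounded: half of the quadratic absorbs the linear term.\<close>

lemma proximal_minimizer_exists:
  fixes g :: "'a::euclidean_space \<Rightarrow> ereal"
  assumes g: "proper_closed_convex g" and t: "t > 0"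
    and minorant: "\<And>w. ereal (c + s \<bullet> w) \<le> g w"
  obtains z where "\<And>w. g z + ereal ((norm (z - v))\<^sup>2 / (2 * t)) \<le> g w + ereal ((norm (w - v))\<^sup>2 / (2 * t))"
proof -
  define q where "q w = (norm (w - v))\<^sup>2 / (2 * t)" for w
  have q0: "q w \<ge> 0" for w using t by (simp add: q_def)
  obtain w0 r0 where w0: "g w0 = ereal r0"
    using g unfolding proper_closed_convex_def by (metis ereal_cases)
  define K where "K = r0 + q w0"
  \<comment> \<open>The search takes place in the epigraph, not in the space of w: closedness of the
    epigraph encodes lower semicontinuity of g, and on pairs (w, r) the objective is real-valued and
    continuous.\<close>
  define S where "S = {p \<in> ereal_epigraph g. snd p + q (fst p) \<le> K}"
  \<comment> \<open>With u = w - v, half of |u|^2 / (2 t) dominates -s.u up to t |s|^2, because |2 t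
    s + u|^2 / (4 t) is nonnegative. The other half is thereby bounded, and \<open>R\<close> is the
    resulting radius.\<close>
  define R where "R = sqrt (4 * t * (K - c - s \<bullet> v + t * (norm s)\<^sup>2))"
  define lo where "lo = c + s \<bullet> v - norm s * R"
  have "S \<subseteq> cball v R \<times> {lo..K}"
  proof
    fix p assume "p \<in> S"
    then obtain w r where p: "p = (w, r)" and "g w \<le> ereal r" and K: "r + q w \<le> K"
      by (cases p) (auto simp: S_def ereal_epigraph_def)
    with minorant[of w] have r: "c + s \<bullet> w \<le> r" by (metis ereal_less_eq(3) order_trans)
    have sw: "s \<bullet> w = s \<bullet> v + s \<bullet> (w - v)" by (simp add: inner_diff_right)
    define u where "u = w - v"
    have "0 \<le> (((2 * t) *\<^sub>R s + u) \<bullet> ((2 * t) *\<^sub>R s + u)) / (4 * t)" using t by simp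
    also have "\<dots> = t * (s \<bullet> s) + s \<bullet> u + (u \<bullet> u) / (4 * t)"
      using t by (simp add: inner_add_left inner_add_right inner_commute[of u s]) (simp add: field_simps)
    also have "\<dots> = t * (norm s)\<^sup>2 + s \<bullet> (w - v) + (norm (w - v))\<^sup>2 / (4 * t)"
      by (simp add: u_def power2_norm_eq_inner)
    finally have "- (t * (norm s)\<^sup>2) - (norm (w - v))\<^sup>2 / (4 * t) \<le> s \<bullet> (w - v)" by simp
    moreover have "q w = 2 * ((norm (w - v))\<^sup>2 / (4 * t))" by (simp add: q_def)
    ultimately have "(norm (w - v))\<^sup>2 / (4 * t) \<le> K - c - s \<bullet> v + t * (norm s)\<^sup>2"
      using r K sw by linarith
    then have "(norm (w - v))\<^sup>2 \<le> 4 * t * (K - c - s \<bullet> v + t * (norm s)\<^sup>2)"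
      using t by (simp add: field_simps)
    then have R: "norm (w - v) \<le> R" unfolding R_def by (rule real_le_rsqrt)
    have "- (norm s * norm (w - v)) \<le> s \<bullet> (w - v)"
      using norm_cauchy_schwarz[of "- s" "w - v"] by simp
    moreover have "norm s * norm (w - v) \<le> norm s * R" using R by (intro mult_left_mono) auto
    ultimately have "lo \<le> r" using r sw by (simp add: lo_def)
    moreover have "r \<le> K" using K q0[of w] by simp
    ultimately show "p \<in> cball v R \<times> {lo..K}"
      using R by (simp add: p dist_norm norm_minus_commute)
  qed
  moreover have "closed S"
  proof -
    have "S = ereal_epigraph g \<inter> {p. snd p + q (fst p) \<le> K}" by (auto simp: S_def)
    moreover have "closed (ereal_epigraph g)" using g by (simp add: proper_closed_convex_def)
    moreover have "closed {p::'a \<times> real. snd p + q (fst p) \<le> K}"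
      unfolding q_def by (intro closed_Collect_le continuous_intros) (use t in auto)
    ultimately show ?thesis by auto
  qed
  ultimately have "compact S"
    using compact_Int_closed[OF compact_Times[OF compact_cball compact_Icc], of S v R lo K]
    by (simp add: Int_absorb1)
  moreover have "(w0, r0) \<in> S" by (simp add: S_def K_def w0 ereal_epigraph_def)
  moreover have "continuous_on S (\<lambda>p. snd p + q (fst p))"
    unfolding q_def by (intro continuous_intros) (use t in auto)
  ultimately obtain p where p: "p \<in> S" and min: "\<And>p'. p' \<in> S \<Longrightarrow> snd p + q (fst p) \<le> snd p' + q (fst p')"
    using continuous_attains_inf[of S "\<lambda>p. snd p + q (fst p)"] by blast
  show ?thesis
  proof (rule that[of "fst p"], fold q_def)
    fix w
    have "g (fst p) + ereal (q (fst p)) \<le> ereal (snd p) + ereal (q (fst p))"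
      using p by (intro add_right_mono) (auto simp: S_def ereal_epigraph_def)
    also have "\<dots> \<le> g w + ereal (q w)"
    proof (cases "g w")
      case (real r)
      show ?thesis
      proof (cases "(w, r) \<in> S")
        case True
        from min[OF this] show ?thesis by (simp add: real)
      next
        case False
        \<comment> \<open>A point outside \<open>S\<close> already has objective above
          \<open>K\<close>, hence above the minimum attained on \<open>S\<close>.\<close>
        then have "K < r + q w" by (auto simp: S_def ereal_epigraph_def real)
        moreover have "snd p + q (fst p) \<le> K" using p by (simp add: S_def)
        ultimately show ?thesis by (simp add: real)
      qed
    qed (use g in \<open>auto simp: proper_closed_convex_def\<close>)
    finally show "g (fst p) + ereal (q (fst p)) \<le> g w + ereal (q w)" .
  qed
qed

section \<open>Agents and block matrices\<close>

lemma agent_simps [simp]: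
  "agent (x + y) i = agent x i + agent y i"
  "agent (x - y) i = agent x i - agent y i"
  "agent (- x) i = - agent x i"
  "agent (c *\<^sub>R x) i = c *\<^sub>R agent x i"
  "agent 0 i = 0"
  by (simp_all add: agent_def vec_eq_iff)

lemma agent_agent_diag [simp]: "agent (agent_diag c *v x) i = c i *\<^sub>R agent x i"
  by (simp add: agent_def agent_diag_def matrix_vector_mult_def vec_eq_iff if_distribR if_distrib sum.delta
      cong: if_cong)

lemma bounded_linear_agent: "bounded_linear (\<lambda>x. agent x i)"
  unfolding linear_conv_bounded_linear[symmetric] by (rule linearI) simp_all

lemmas tendsto_agent [tendsto_intros] = bounded_linear.tendsto[OF bounded_linear_agent]

lemma agent_sum [simp]: "agent (\<Sum>j\<in>S. h j) i = (\<Sum>j\<in>S. agent (h j) i)"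
  using linear_sum[OF bounded_linear.linear[OF bounded_linear_agent]] .

lemma inner_agent: "x \<bullet> y = (\<Sum>i\<in>UNIV. agent x i \<bullet> agent y i)"
proof -
  have "(\<Sum>p\<in>UNIV. x $ p \<bullet> y $ p) = (\<Sum>i\<in>UNIV. \<Sum>j\<in>UNIV. x $ (i, j) \<bullet> y $ (i, j))"
    by (simp only: sum.cartesian_product UNIV_Times_UNIV case_prod_eta split_def prod.collapse)
  then show ?thesis by (simp only: inner_vec_def agent_def vec_lambda_beta)
qed

lemma norm_agent: "(norm x)\<^sup>2 = (\<Sum>i\<in>UNIV. (norm (agent x i))\<^sup>2)"
  by (simp add: power2_norm_eq_inner inner_agent[of x x])

lemma agent_eqI: "(\<And>i. agent x i = agent y i) \<Longrightarrow> x = y"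
  by (auto simp: vec_eq_iff agent_def)

text \<open>Right inverse of the family of maps \<open>agent\<close>: it turns per-agent gradients,
  minimizers and test points into one vector.\<close>

definition stack :: "('N::finite \<Rightarrow> real ^ 'n::finite) \<Rightarrow> ('N, 'n) svec" where
  "stack y = (\<chi> p. y (fst p) $ snd p)"

lemma agent_stack [simp]: "agent (stack y) i = y i"
  by (simp add: agent_def stack_def vec_eq_iff)

lemma agent_kron_ones [simp]: "agent (kron_vec (\<chi> i. 1) z) i = z"
  by (simp add: agent_def kron_vec_def vec_eq_iff)

lemma agent_diag_mult: "agent_diag a ** agent_diag b = agent_diag (\<lambda>i. a i * b i)"
  unfolding matrix_eq matrix_vector_mul_assoc[symmetric] by (intro allI agent_eqI) simp

lemma agent_diag_one: "agent_diag (\<lambda>i. 1) = mat 1"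
  by (simp add: agent_diag_def mat_def)

lemma transpose_agent_diag [simp]: "transpose (agent_diag c) = agent_diag c"
  by (auto simp: agent_diag_def transpose_def vec_eq_iff)

text \<open>\<open>matrix_inv\<close> is a choice among two-sided inverses. For square matrices the
  right inverse B is also a left inverse, so the choice is meaningful and associativity identifies
  it with B.\<close>

lemma matrix_inv_eqI:
  fixes A B :: "real ^ 'a ^ 'a"
  assumes "A ** B = mat 1"
  shows "matrix_inv A = B"
proof -
  have BA: "B ** A = mat 1" using assms by (simp add: matrix_left_right_inverse)
  then have inv: "A ** matrix_inv A = mat 1"
    unfolding matrix_inv_def using someI[of "\<lambda>A'. A ** A' = mat 1 \<and> A' ** A = mat 1" B] assms by auto
  have "matrix_inv A = (B ** A) ** matrix_inv A" using BA by simp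
  also have "\<dots> = B" by (simp add: matrix_mul_assoc[symmetric] inv)
  finally show ?thesis .
qed

lemma matrix_inv_agent_diag:
  assumes "\<And>i. c i \<noteq> 0"
  shows "matrix_inv (agent_diag c) = agent_diag (\<lambda>i. 1 / c i)"
  using assms by (intro matrix_inv_eqI) (simp add: agent_diag_mult agent_diag_one)

section \<open>Calculus of two-block vectors and matrices\<close>

lemma sum_UNIV_Plus:
  "(\<Sum>r\<in>UNIV. h r) = (\<Sum>p\<in>UNIV. h (Inl p)) + (\<Sum>q\<in>UNIV. h (Inr q :: 'a::finite + 'b::finite))"
  using sum.Plus[of UNIV UNIV h] by simp

lemma inner_col2 [simp]: "col2 x y \<bullet> col2 x' y' = x \<bullet> x' + y \<bullet> y'"
  by (simp add: col2_def inner_vec_def sum_UNIV_Plus)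

lemma col2_simps [simp]:
  "col2 x y + col2 x' y' = col2 (x + x') (y + y')"
  "col2 x y - col2 x' y' = col2 (x - x') (y - y')"
  "c *\<^sub>R col2 x y = col2 (c *\<^sub>R x) (c *\<^sub>R y)"
  "col2 x y = col2 x' y' \<longleftrightarrow> x = x' \<and> y = y'"
  by (simp_all add: col2_def vec_eq_iff split_sum_all)

lemma norm_col2: "(norm (col2 x y))\<^sup>2 = (norm x)\<^sup>2 + (norm y)\<^sup>2"
  by (simp only: power2_norm_eq_inner inner_col2)

lemma tendsto_col2:
  assumes "(f \<longlongrightarrow> a) F" "(g \<longlongrightarrow> b) F"
  shows "((\<lambda>k. col2 (f k) (g k)) \<longlongrightarrow> col2 a b) F"
proof (rule vec_tendstoI)
  show "((\<lambda>k. col2 (f k) (g k) $ r) \<longlongrightarrow> col2 a b $ r) F" for r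
    using tendsto_vec_nth[OF assms(1)] tendsto_vec_nth[OF assms(2)]
    by (cases r) (simp_all add: col2_def)
qed

lemma col2_zero [simp]: "col2 0 0 = 0"
  by (simp add: col2_def vec_eq_iff split: sum.split)

lemma col2_exhaust: obtains a b where "u = col2 a b"
proof
  show "u = col2 (\<chi> p. u $ Inl p) (\<chi> q. u $ Inr q)"
    by (simp add: vec_eq_iff split_sum_all col2_def)
qed

lemma tendsto_col2_iff:
  "((\<lambda>k. col2 (f k) (g k)) \<longlongrightarrow> col2 a b) F \<longleftrightarrow> (f \<longlongrightarrow> a) F \<and> (g \<longlongrightarrow> b) F"
proof
  assume L: "((\<lambda>k. col2 (f k) (g k)) \<longlongrightarrow> col2 a b) F"
  have "((\<lambda>k. f k $ p) \<longlongrightarrow> a $ p) F" for p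
    using tendsto_vec_nth[OF L, of "Inl p"] by (simp add: col2_def)
  moreover have "((\<lambda>k. g k $ q) \<longlongrightarrow> b $ q) F" for q
    using tendsto_vec_nth[OF L, of "Inr q"] by (simp add: col2_def)
  ultimately show "(f \<longlongrightarrow> a) F \<and> (g \<longlongrightarrow> b) F" by (auto intro: vec_tendstoI)
qed (auto intro: tendsto_col2)

lemma block2_mult_col2 [simp]:
  "block2 A B C D *v col2 x y = col2 (A *v x + B *v y) (C *v x + D *v y)"
  by (simp add: block2_def col2_def matrix_vector_mult_def vec_eq_iff split_sum_all sum_UNIV_Plus)

lemma block2_mult [simp]:
  "block2 A B C D ** block2 A' B' C' D'
    = block2 (A ** A' + B ** C') (A ** B' + B ** D') (C ** A' + D ** C') (C ** B' + D ** D')"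
  by (simp add: block2_def matrix_matrix_mult_def vec_eq_iff split_sum_all sum_UNIV_Plus)

lemma block2_add [simp]:
  "block2 A B C D + block2 A' B' C' D' = block2 (A + A') (B + B') (C + C') (D + D')"
  by (simp add: block2_def vec_eq_iff split_sum_all)

lemma block2_diff [simp]:
  "block2 A B C D - block2 A' B' C' D' = block2 (A - A') (B - B') (C - C') (D - D')"
  by (simp add: block2_def vec_eq_iff split_sum_all)

lemma block2_scaleR [simp]:
  "c *\<^sub>R block2 A B C D = block2 (c *\<^sub>R A) (c *\<^sub>R B) (c *\<^sub>R C) (c *\<^sub>R D)"
  by (simp add: block2_def vec_eq_iff split_sum_all)

lemma transpose_block2 [simp]:
  "transpose (block2 A B C D) = block2 (transpose A) (transpose C) (transpose B) (transpose D)"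
  by (simp add: block2_def transpose_def vec_eq_iff split_sum_all)

lemma block2_one: "block2 (mat 1) 0 0 (mat 1) = mat 1"
  by (simp add: block2_def mat_def vec_eq_iff split_sum_all)

lemma matrix_inv_M_mat: "matrix_inv (M_mat \<tau> W) = block2 (mat 1) (- (agent_diag \<tau> ** V_mat W)) 0 (mat 1)"
  unfolding M_mat_def by (rule matrix_inv_eqI) (simp add: block2_one)

lemma matrix_mul_minus_right: "A ** (- B) = - (A ** B :: real ^ 'a ^ 'b)"
  by (simp add: matrix_matrix_mult_def vec_eq_iff sum_negf)

lemma agent_diag_inverse_cancel:
  assumes "\<And>i. c i \<noteq> 0"
  shows "agent_diag (\<lambda>i. 1 / c i) ** (agent_diag c ** X) = X"
    and "X ** agent_diag c ** agent_diag (\<lambda>i. 1 / c i) = X"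
  using assms by (simp_all add: agent_diag_mult agent_diag_one matrix_mul_assoc
      flip: matrix_mul_assoc[of X])

lemma transpose_zero [simp]: "transpose (0 :: real ^ 'a ^ 'b) = 0"
  by (simp add: transpose_def vec_eq_iff)

text \<open>The upper right block of the product is \<open>V\<close> minus the inverse of \<Gamma>
  times \<Gamma>\<open>V\<close>, which is zero. The correction matrix \<open>M_mat\<close> makes
  the metric block diagonal.\<close>

lemma H_mat_eq:
  assumes "\<And>i. \<tau> i \<noteq> 0"
  shows "H_mat \<tau> \<beta> W = block2 (agent_diag (\<lambda>i. 1 / \<tau> i)) 0 0 ((1 / \<beta>) *\<^sub>R mat 1)"
  by (simp add: H_mat_def Q_mat_def matrix_inv_M_mat matrix_inv_agent_diag assms
      matrix_mul_minus_right agent_diag_inverse_cancel)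

text \<open>Symmetry of \<open>V\<close> makes the off-diagonal blocks of Q^T + Q and of M^T H M the
  same, so they cancel. The lower right block of M^T H M contains V \<Gamma> V, the only coupling
  that survives.\<close>

lemma H1_mat_eq:
  fixes W :: "real ^ 'N ^ 'N"
  assumes \<tau>: "\<And>i. \<tau> i \<noteq> 0" and V: "transpose (V_mat W) = (V_mat W :: ('N::finite, 'n::finite) smat)"
  shows "(H1_mat L \<tau> \<beta> W :: ('N, 'n) bmat)
    = block2 (agent_diag (\<lambda>i. 1 / \<tau> i - L i / 2)) 0 0
        ((1 / \<beta>) *\<^sub>R mat 1 - V_mat W ** (agent_diag \<tau> ** V_mat W))"
proof -
  let ?T = "agent_diag \<tau> :: ('N, 'n) smat" and ?I = "agent_diag (\<lambda>i. 1 / \<tau> i) :: ('N, 'n) smat"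
    and ?V = "V_mat W :: ('N, 'n) smat" and ?M = "M_mat \<tau> W :: ('N, 'n) bmat"
    and ?H = "H_mat \<tau> \<beta> W :: ('N, 'n) bmat"
  define Y :: "('N, 'n) smat" where "Y = (1 / \<beta>) *\<^sub>R mat 1"
  have Y: "transpose Y = Y" by (simp add: Y_def transpose_scalar)
  have HM: "?H ** ?M = block2 ?I ?V 0 Y"
    using \<tau> by (simp add: Y_def H_mat_eq M_mat_def agent_diag_inverse_cancel)
  have M: "transpose ?M = block2 (mat 1) 0 (?V ** ?T) (mat 1)"
    by (simp add: M_mat_def matrix_transpose_mul V)
  have Q: "Q_mat \<tau> \<beta> W = block2 ?I ?V 0 Y"
    by (simp add: Y_def Q_mat_def matrix_inv_agent_diag \<tau>)
  have *: "?I - (1/2) *\<^sub>R agent_diag L = agent_diag (\<lambda>i. 1 / \<tau> i - L i / 2)"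
    by (simp add: agent_diag_def vec_eq_iff)
  have "transpose ?M ** ?H ** ?M = block2 ?I ?V ?V (?V ** (?T ** ?V) + Y)"
  proof -
    have "transpose ?M ** ?H ** ?M = transpose ?M ** (?H ** ?M)" by (simp only: matrix_mul_assoc)
    then show ?thesis
      unfolding HM M by (simp add: agent_diag_inverse_cancel(2)[OF \<tau>]) (simp only: matrix_mul_assoc)
  qed
  then show ?thesis
    unfolding H1_mat_def G_mat_def Q
    by (simp add: V Y *) (simp add: Y_def)
qed

section \<open>Separable minimization and quadratic forms of stochastic matrices\<close>

lemma GDERIV_inner_right: "GDERIV (\<lambda>w. a \<bullet> w) z :> a"
  unfolding gderiv_def by (auto intro!: derivative_eq_intros simp: inner_commute)

lemma GDERIV_proximal_term: "t \<noteq> 0 \<Longrightarrow> GDERIV (\<lambda>w. (norm (w - v))\<^sup>2 / (2 * t)) z :> (1 / t) *\<^sub>R (z - v)"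
  unfolding gderiv_def power2_norm_eq_inner
  by (auto intro!: derivative_eq_intros simp: inner_commute)

lemma gradient_F_sum:
  assumes "\<And>i. smooth_fun (L i) (f i)"
  shows "agent (gradient (F_sum f) x) i = gradient (f i) (agent x i)"
proof -
  have "(F_sum f has_derivative (\<lambda>h. \<Sum>i\<in>UNIV. agent h i \<bullet> gradient (f i) (agent x i))) (at x)"
    unfolding F_sum_def
  proof (rule has_derivative_sum)
    fix i
    have "(f i has_derivative (\<lambda>h. h \<bullet> gradient (f i) (agent x i))) (at (agent x i))"
      using smooth_fun_GDERIV[OF assms] by (simp only: gderiv_def)
    from has_derivative_compose[OF bounded_linear_imp_has_derivative[OF bounded_linear_agent] this]
    show "((\<lambda>x. f i (agent x i)) has_derivative (\<lambda>h. agent h i \<bullet> gradient (f i) (agent x i))) (at x)" .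
  qed
  then have "GDERIV (F_sum f) x :> stack (\<lambda>i. gradient (f i) (agent x i))"
    unfolding gderiv_def inner_agent by simp
  then show ?thesis by (simp only: gradient_eqI agent_stack)
qed

text \<open>From the joint to the individual minimum, a single agent is changed and the other terms
  are cancelled. Cancellation in \<open>ereal\<close> needs those terms finite.\<close>

lemma separable_minimum_iff:
  assumes proper: "\<And>i w. g i w \<noteq> -\<infinity>" "\<And>i. \<exists>w. g i w \<noteq> \<infinity>"
  shows "(\<forall>y. G_sum g z + ereal (\<Sum>i\<in>UNIV. h i (agent z i)) \<le> G_sum g y + ereal (\<Sum>i\<in>UNIV. h i (agent y i)))
    \<longleftrightarrow> (\<forall>i w. g i (agent z i) + ereal (h i (agent z i)) \<le> g i w + ereal (h i w))"
proof -
  define \<phi> where "\<phi> i w = g i w + ereal (h i w)" for i w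
  have \<phi>: "G_sum g y + ereal (\<Sum>i\<in>UNIV. h i (agent y i)) = (\<Sum>i\<in>UNIV. \<phi> i (agent y i))" for y
    by (simp add: G_sum_def \<phi>_def sum.distrib)
  have minf: "\<phi> i w \<noteq> -\<infinity>" for i w using proper(1)[of i w] by (simp add: \<phi>_def)
  have "\<phi> i (agent z i) \<le> \<phi> i w"
    if min: "\<And>y. (\<Sum>i\<in>UNIV. \<phi> i (agent z i)) \<le> (\<Sum>i\<in>UNIV. \<phi> i (agent y i))" for i w
  proof -
    \<comment> \<open>One point in each domain suffices, since the agents have independent
      variables; comparison with this finite value makes every term at the minimizer finite.\<close>
    obtain p where p: "\<And>i. g i (p i) \<noteq> \<infinity>" using proper(2) by metis
    have "(\<Sum>i\<in>UNIV. \<phi> i (agent z i)) \<le> (\<Sum>i\<in>UNIV. \<phi> i (p i))"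
      using min[of "stack p"] by simp
    moreover have "(\<Sum>i\<in>UNIV. \<phi> i (p i)) \<noteq> \<infinity>" using p by (simp add: sum_Pinfty \<phi>_def)
    ultimately have "(\<Sum>i\<in>UNIV. \<phi> i (agent z i)) \<noteq> \<infinity>" by auto
    then have pinf: "\<phi> i (agent z i) \<noteq> \<infinity>" for i by (simp add: sum_Pinfty)
    let ?r = "\<Sum>j\<in>UNIV - {i}. \<phi> j (agent z j)"
    have "\<phi> i (agent z i) + ?r = (\<Sum>j\<in>UNIV. \<phi> j (agent z j))"
      by (rule sum.remove[symmetric]) auto
    also have "\<dots> \<le> (\<Sum>j\<in>UNIV. \<phi> j (if j = i then w else agent z j))"
      using min[of "stack (\<lambda>j. if j = i then w else agent z j)"] by simp
    also have "\<dots> = \<phi> i w + (\<Sum>j\<in>UNIV - {i}. \<phi> j (if j = i then w else agent z j))"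
      by (subst sum.remove[of _ i]) auto
    also have "(\<Sum>j\<in>UNIV - {i}. \<phi> j (if j = i then w else agent z j)) = ?r"
      by (intro sum.cong) auto
    finally have "\<phi> i (agent z i) + ?r \<le> \<phi> i w + ?r" .
    moreover have "\<bar>?r\<bar> \<noteq> \<infinity>" using pinf minf by (auto simp: sum_Inf ereal_infinity_cases)
    ultimately show ?thesis by (auto simp: ereal_add_le_add_iff2)
  qed
  then show ?thesis unfolding \<phi> \<phi>_def[symmetric] by (auto intro: sum_mono)
qed

text \<open>The weighted norm splits over the agents, so the proximal problem separates. The
  minorants give a minimizer per agent; the subgradient inequality is then the first-order condition
  for each one.\<close>

lemma prox_subgradient:
  fixes g :: "'N::finite \<Rightarrow> real ^ 'n::finite \<Rightarrow> ereal"
  assumes g: "\<And>i. proper_closed_convex (g i)" and \<tau>: "\<And>i. \<tau> i > 0"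
    and minorant: "\<And>i w. ereal (c i + s i \<bullet> w) \<le> g i w"
    and z: "z = prox (matrix_inv (agent_diag \<tau>)) (G_sum g) v"
  shows "g i (agent z i) \<noteq> \<infinity>"
    and "g i (agent z i) + ereal ((1 / \<tau> i) *\<^sub>R (agent v i - agent z i) \<bullet> (w - agent z i)) \<le> g i w"
proof -
  define q where "q i w = (norm (w - agent v i))\<^sup>2 / (2 * \<tau> i)" for i w
  define \<Phi> where "\<Phi> y = G_sum g y + ereal (\<Sum>i\<in>UNIV. q i (agent y i))" for y
  have proper: "\<And>i w. g i w \<noteq> -\<infinity>" "\<And>i. \<exists>w. g i w \<noteq> \<infinity>"
    using g by (auto simp: proper_closed_convex_def)
  have \<Phi>: "G_sum g y + ereal (1/2 * sqnorm_mat (matrix_inv (agent_diag \<tau>)) (y - v)) = \<Phi> y" for y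
  proof -
    have "\<tau> i \<noteq> 0" for i using \<tau>[of i] by simp
    then have "1/2 * sqnorm_mat (matrix_inv (agent_diag \<tau>)) (y - v) = (\<Sum>i\<in>UNIV. q i (agent y i))"
      by (simp add: sqnorm_mat_def matrix_inv_agent_diag inner_agent q_def power2_norm_eq_inner
          sum_divide_distrib mult.commute)
    then show ?thesis by (simp add: \<Phi>_def)
  qed
  have "\<exists>p. \<forall>w. g i p + ereal (q i p) \<le> g i w + ereal (q i w)" for i
    using proximal_minimizer_exists[OF g \<tau> minorant, of i "agent v i"] unfolding q_def by metis
  then obtain p where p: "\<And>i w. g i (p i) + ereal (q i (p i)) \<le> g i w + ereal (q i w)" by metis
  have "\<forall>y. \<Phi> (stack p) \<le> \<Phi> y"
    unfolding \<Phi>_def separable_minimum_iff[where h = q, OF proper] using p by simp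
  \<comment> \<open>The stacked minimizers only witness that a minimizer exists; the point chosen by
    \<open>prox\<close> thereby is a minimizer too.\<close>
  then have "is_arg_min \<Phi> (\<lambda>_. True) (stack p)" by (auto simp: is_arg_min_def not_less)
  then have "is_arg_min \<Phi> (\<lambda>_. True) z"
    unfolding z prox_def \<Phi> arg_min_def by (rule someI)
  then have "\<forall>y. \<Phi> z \<le> \<Phi> y" by (auto simp: is_arg_min_def not_less)
  then have min: "g i (agent z i) + ereal (q i (agent z i)) \<le> g i w + ereal (q i w)" for i w
    unfolding \<Phi>_def separable_minimum_iff[where h = q, OF proper] by simp
  show fin: "g i (agent z i) \<noteq> \<infinity>" using min[of i] proper(2)[of i] by force
  have "g i (agent z i) + ereal (- ((w - agent z i) \<bullet> ((1 / \<tau> i) *\<^sub>R (agent z i - agent v i)))) \<le> g i w"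
  proof (rule convex_smooth_minimum_subgradient)
    have "\<tau> i \<noteq> 0" using \<tau>[of i] by simp
    then show "GDERIV (q i) (agent z i) :> (1 / \<tau> i) *\<^sub>R (agent z i - agent v i)"
      unfolding q_def by (rule GDERIV_proximal_term)
  qed (use g min fin proper(1) in \<open>auto simp: proper_closed_convex_def\<close>)
  moreover have "- ((w - agent z i) \<bullet> ((1 / \<tau> i) *\<^sub>R (agent z i - agent v i)))
      = (1 / \<tau> i) *\<^sub>R (agent v i - agent z i) \<bullet> (w - agent z i)"
    by (metis inner_commute inner_minus_left minus_diff_eq scaleR_minus_right)
  ultimately show "g i (agent z i) + ereal ((1 / \<tau> i) *\<^sub>R (agent v i - agent z i) \<bullet> (w - agent z i)) \<le> g i w"
    by simp
qed

section \<open>Quadratic forms of averaging matrices\<close>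

lemma agent_kron_mat: "agent (kron_mat W (mat 1) *v x) i = (\<Sum>j\<in>UNIV. W $ i $ j *\<^sub>R agent x j)"
proof -
  have "(\<Sum>p\<in>UNIV. W $ i $ fst p * (if l = snd p then 1 else 0) * x $ p) = (\<Sum>j\<in>UNIV. W $ i $ j * x $ (j, l))" for l
  proof -
    have "(\<Sum>p\<in>UNIV. W $ i $ fst p * (if l = snd p then 1 else 0) * x $ p)
      = (\<Sum>j\<in>UNIV. \<Sum>m\<in>UNIV. W $ i $ j * (if l = m then 1 else 0) * x $ (j, m))"
      by (simp only: sum.cartesian_product UNIV_Times_UNIV split_def prod.collapse)
    also have "\<dots> = (\<Sum>j\<in>UNIV. \<Sum>m\<in>UNIV. if l = m then W $ i $ j * x $ (j, l) else 0)"
      by (intro sum.cong) auto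
    finally show ?thesis by simp
  qed
  then show ?thesis
    by (simp add: vec_eq_iff agent_def kron_mat_def matrix_vector_mult_def mat_def)
qed

lemma doubly_stochastic_sum_weights:
  assumes "doubly_stochastic W"
  shows "(\<Sum>i\<in>UNIV. \<Sum>j\<in>UNIV. W $ i $ j * c i) = (\<Sum>i\<in>UNIV. c i)"
    and "(\<Sum>i\<in>UNIV. \<Sum>j\<in>UNIV. W $ i $ j * c j) = (\<Sum>i\<in>UNIV. c i)"
proof -
  show "(\<Sum>i\<in>UNIV. \<Sum>j\<in>UNIV. W $ i $ j * c i) = (\<Sum>i\<in>UNIV. c i)"
    using assms by (simp add: doubly_stochastic_def flip: sum_distrib_right)
  show "(\<Sum>i\<in>UNIV. \<Sum>j\<in>UNIV. W $ i $ j * c j) = (\<Sum>i\<in>UNIV. c i)"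
    by (subst sum.swap) (use assms in \<open>simp add: doubly_stochastic_def flip: sum_distrib_right\<close>)
qed

text \<open>Expanding the squares, row and column sums equal to 1 turn the two diagonal
  contributions into 2 x.x. Both signs of s are used: s = -1 shows that I - W is positive
  semidefinite, s = 1 bounds W from below.\<close>

lemma doubly_stochastic_quadratic_form:
  assumes W: "doubly_stochastic W" and s: "s\<^sup>2 = (1::real)"
  shows "x \<bullet> x + s * (x \<bullet> (kron_mat W (mat 1) *v x))
    = (\<Sum>i\<in>UNIV. \<Sum>j\<in>UNIV. W $ i $ j * (norm (agent x i + s *\<^sub>R agent x j))\<^sup>2) / 2"
proof -
  have "(\<Sum>i\<in>UNIV. \<Sum>j\<in>UNIV. W $ i $ j * (norm (agent x i + s *\<^sub>R agent x j))\<^sup>2)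
    = (\<Sum>i\<in>UNIV. \<Sum>j\<in>UNIV. W $ i $ j * (agent x i \<bullet> agent x i) + W $ i $ j * (agent x j \<bullet> agent x j)
        + 2 * s * (W $ i $ j * (agent x i \<bullet> agent x j)))"
  proof (intro sum.cong refl)
    fix i j
    have "(norm (agent x i + s *\<^sub>R agent x j))\<^sup>2
      = agent x i \<bullet> agent x i + s\<^sup>2 * (agent x j \<bullet> agent x j) + 2 * s * (agent x i \<bullet> agent x j)"
      unfolding power2_norm_eq_inner inner_add_left inner_add_right
      by (simp add: inner_commute[of "agent x j" "agent x i"] power2_eq_square)
    then show "W $ i $ j * (norm (agent x i + s *\<^sub>R agent x j))\<^sup>2
      = W $ i $ j * (agent x i \<bullet> agent x i) + W $ i $ j * (agent x j \<bullet> agent x j)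
        + 2 * s * (W $ i $ j * (agent x i \<bullet> agent x j))"
      unfolding s by (simp add: algebra_simps)
  qed
  also have "\<dots> = 2 * (x \<bullet> x) + 2 * s * (x \<bullet> (kron_mat W (mat 1) *v x))"
    unfolding sum.distrib doubly_stochastic_sum_weights[OF W]
    by (simp add: inner_agent agent_kron_mat inner_sum_right sum_distrib_left)
  finally show ?thesis by simp
qed

section \<open>Mixing matrices and perturbed descent sequences\<close>

lemma finite_range_pos_lower_bound:
  fixes c :: "'a::finite \<Rightarrow> real"
  assumes "\<And>i. c i > 0"
  obtains m where "m > 0" "\<And>i. m \<le> c i"
proof
  show "Min (range c) > 0" using assms by simp
  show "Min (range c) \<le> c i" for i by simp
qed

lemma kron_mat_symmetric:
  assumes "transpose W = W"
  shows "transpose (kron_mat W (mat 1)) = kron_mat W (mat 1)"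
proof -
  have "W $ i $ j = W $ j $ i" for i j
    using assms by (metis transpose_def vec_lambda_beta)
  then show ?thesis by (simp add: kron_mat_def mat_def transpose_def vec_eq_iff)
qed

locale mixing =
  fixes W :: "real ^ 'N::finite ^ 'N" and E :: "('N \<times> 'N) set"
  assumes mixing: "mixing_matrix E W"
begin

lemma stochastic: "doubly_stochastic W" and symmetric: "transpose W = W"
  using mixing by (auto simp: mixing_matrix_def)

lemma weight_nonneg: "0 \<le> W $ i $ j"
  using stochastic by (simp add: doubly_stochastic_def)

text \<open>The vanishing clause concerns only distinct non-neighbours, so a diagonal entry falls
  under the positive case whether or not the edge set contains loops.\<close>

lemma diag_pos: "W $ i $ i > 0"
  using mixing unfolding mixing_matrix_def by metis

lemma laplacian_pos_semidef: "pos_semidef (mat 1 - kron_mat W (mat 1) :: ('N, 'n::finite) smat)"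
proof -
  let ?K = "kron_mat W (mat 1) :: ('N, 'n) smat"
  have "transpose (mat 1 - ?K) = mat 1 - transpose ?K"
    by (auto simp: transpose_def mat_def vec_eq_iff)
  moreover have "0 \<le> x \<bullet> ((mat 1 - ?K) *v x)" for x
  proof -
    have "x \<bullet> ((mat 1 - ?K) *v x) = x \<bullet> x + (-1) * (x \<bullet> (?K *v x))"
      by (simp add: matrix_vector_mult_diff_rdistrib inner_diff_right)
    also have "\<dots> = (\<Sum>i\<in>UNIV. \<Sum>j\<in>UNIV. W $ i $ j * (norm (agent x i + (-1) *\<^sub>R agent x j))\<^sup>2) / 2"
      by (rule doubly_stochastic_quadratic_form[OF stochastic]) simp
    also have "\<dots> \<ge> 0" by (intro divide_nonneg_nonneg sum_nonneg mult_nonneg_nonneg weight_nonneg) auto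
    finally show ?thesis .
  qed
  ultimately show ?thesis by (simp add: pos_semidef_def kron_mat_symmetric symmetric)
qed

lemma V_mat_symmetric: "transpose (V_mat W) = (V_mat W :: ('N, 'n::finite) smat)"
proof -
  have "pos_semidef (V_mat W :: ('N, 'n) smat)"
    unfolding V_mat_def by (rule psd_sqrt(1)[OF laplacian_pos_semidef])
  then show ?thesis by (simp add: pos_semidef_def)
qed

lemma inner_V_mat: "x \<bullet> (V_mat W *v y) = (V_mat W *v x) \<bullet> y"
  by (rule symmetric_matrix_inner[OF V_mat_symmetric])

lemma V_mat_square:
  fixes x :: "('N, 'n::finite) svec"
  shows "V_mat W *v (V_mat W *v x) = x - kron_mat W (mat 1) *v x"
proof -
  have "V_mat W ** V_mat W = (mat 1 - kron_mat W (mat 1) :: ('N, 'n) smat)"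
    unfolding V_mat_def by (rule psd_sqrt(2)[OF laplacian_pos_semidef])
  then show ?thesis
    by (simp add: matrix_vector_mul_assoc matrix_vector_mult_diff_rdistrib)
qed

text \<open>\<open>V_mat\<close> has no formula for its entries. Symmetry moves one factor across,
  so that only its square, the Laplacian I - W, is needed.\<close>

lemma norm_V_mat: "(norm (V_mat W *v x))\<^sup>2 = x \<bullet> x - x \<bullet> (kron_mat W (mat 1) *v x)"
  unfolding power2_norm_eq_inner inner_V_mat[symmetric] V_mat_square by (simp add: inner_diff_right)

lemma V_mat_kron_ones [simp]: "V_mat W *v kron_vec (\<chi> i. 1) z = 0"
proof -
  have "kron_mat W (mat 1) *v kron_vec (\<chi> i. 1) z = kron_vec (\<chi> i. 1) z"
    by (rule agent_eqI)
       (use stochastic in \<open>simp add: agent_kron_mat doubly_stochastic_def flip: scaleR_sum_left\<close>)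
  then have "(norm (V_mat W *v kron_vec (\<chi> i. 1) z))\<^sup>2 = 0"
    unfolding norm_V_mat by simp
  then show ?thesis by simp
qed

text \<open>Applying \<open>V\<close> once more gives (I - W) x = 0. For each coordinate j, the
  vector of j-th coordinates of all agents is then in the null space of I - W, hence
  constant.\<close>

lemma V_mat_eq_0_imp_consensus:
  assumes "V_mat W *v x = 0"
  obtains z where "x = kron_vec (\<chi> i. 1) z"
proof -
  have Kx: "kron_mat W (mat 1) *v x = x" using V_mat_square[of x] assms by simp
  have "\<exists>c. \<forall>i. x $ (i, j) = c" for j
  proof -
    let ?v = "\<chi> i. x $ (i, j)"
    have "(W *v ?v) $ i = ?v $ i" for i
    proof -
      have "(W *v ?v) $ i = agent (kron_mat W (mat 1) *v x) i $ j"
        unfolding agent_kron_mat by (simp add: matrix_vector_mult_def agent_def)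
      then show ?thesis by (simp add: Kx agent_def)
    qed
    then have "(mat 1 - W) *v ?v = 0"
      by (simp add: matrix_vector_mult_diff_rdistrib vec_eq_iff)
    then have "?v \<in> span {\<chi> i. 1}" using mixing by (auto simp: mixing_matrix_def)
    then obtain c where "?v = c *\<^sub>R (\<chi> i. 1)" by (auto simp: span_singleton)
    then show ?thesis by (auto simp: vec_eq_iff)
  qed
  then obtain c where "\<And>i j. x $ (i, j) = c j" by metis
  then have "x = kron_vec (\<chi> i. 1) (\<chi> j. c j)" by (simp add: vec_eq_iff kron_vec_def)
  then show ?thesis by (rule that)
qed

text \<open>The positive diagonal keeps the spectrum of \<open>W\<close> away from \<open>-1\<close>, so that
  \<open>V\<^sup>2 = I - W\<close> stays strictly below \<open>2 I\<close>.\<close>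

lemma norm_V_mat_upper_bound:
  obtains w where "w > 0"
    and "\<And>x :: ('N, 'n::finite) svec. (norm (V_mat W *v x))\<^sup>2 + w * (norm x)\<^sup>2 \<le> 2 * (norm x)\<^sup>2"
proof -
  obtain w where w: "w > 0" "\<And>i. w \<le> W $ i $ i"
    using finite_range_pos_lower_bound[of "\<lambda>i. W $ i $ i"] diag_pos by metis
  have "(norm (V_mat W *v x))\<^sup>2 + 2 * w * (norm x)\<^sup>2 \<le> 2 * (norm x)\<^sup>2" for x :: "('N, 'n) svec"
  proof -
    \<comment> \<open>Only the diagonal terms of the form with s = 1 are kept; each is W_ii |2
      x_i|^2 / 2, hence the factor 2 before \<open>w\<close>.\<close>
    have "2 * w * (norm x)\<^sup>2 = (\<Sum>i\<in>UNIV. w * (norm (agent x i + 1 *\<^sub>R agent x i))\<^sup>2) / 2"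
    proof -
      have "(norm (agent x i + 1 *\<^sub>R agent x i))\<^sup>2 = 4 * (norm (agent x i))\<^sup>2" for i
        unfolding scaleR_one scaleR_2[symmetric] by (simp add: power_mult_distrib)
      then show ?thesis by (simp add: norm_agent[of x] sum_distrib_left mult_ac flip: sum_divide_distrib)
    qed
    also have "\<dots> \<le> (\<Sum>i\<in>UNIV. W $ i $ i * (norm (agent x i + 1 *\<^sub>R agent x i))\<^sup>2) / 2"
      using w by (intro divide_right_mono sum_mono mult_right_mono) auto
    also have "\<dots> \<le> (\<Sum>i\<in>UNIV. \<Sum>j\<in>UNIV. W $ i $ j * (norm (agent x i + 1 *\<^sub>R agent x j))\<^sup>2) / 2"
      by (intro divide_right_mono sum_mono member_le_sum mult_nonneg_nonneg weight_nonneg) auto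
    also have "\<dots> = x \<bullet> x + 1 * (x \<bullet> (kron_mat W (mat 1) *v x))"
      by (rule doubly_stochastic_quadratic_form[OF stochastic, symmetric]) simp
    finally show ?thesis unfolding norm_V_mat by (simp add: dot_square_norm)
  qed
  then show ?thesis using that[of "2 * w"] w by simp
qed

end

section \<open>Scalar recursions with summable errors\<close>

text \<open>Subtracting the partial sums of the errors gives a decreasing sequence, bounded below
  because the partial sums are bounded.\<close>

lemma almost_decreasing_convergent:
  fixes a e :: "nat \<Rightarrow> real"
  assumes pos: "\<And>k. 0 \<le> a k" and step: "\<And>k. a (Suc k) \<le> a k + e k" and sum: "summable e"
  shows "convergent a"
proof -
  define b where "b k = a k - (\<Sum>j<k. e j)" for k
  have conv: "convergent (\<lambda>k. \<Sum>j<k. e j)" using sum by (simp add: summable_iff_convergent)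
  then obtain B where B: "\<And>k. \<bar>\<Sum>j<k. e j\<bar> \<le> B"
    using convergent_imp_Bseq[OF conv] by (auto simp: Bseq_def)
  have "decseq b" unfolding decseq_Suc_iff
  proof
    fix k show "b (Suc k) \<le> b k" using step[of k] by (simp add: b_def)
  qed
  moreover have "- B \<le> b k" for k using pos[of k] B[of k] by (simp add: b_def abs_le_iff)
  ultimately have "convergent b" using decseq_convergent[of b "- B"] by (metis convergentI)
  from convergent_add[OF this conv] show ?thesis by (simp add: b_def)
qed

text \<open>The right-hand side is at most (a + K \<epsilon>)^2. The entry c C of the maximum covers
  the cross term in a; the entry c / sqrt m comes from maximizing 2 c \<epsilon> \<rho> - m \<rho>^2
  over \<rho>.\<close>

lemma perturbed_descent_step:
  fixes a a' \<rho> \<epsilon> m c C :: real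
  assumes "0 \<le> a" "0 \<le> \<epsilon>" and m: "m > 0" and c: "c \<ge> 0" "C \<ge> 0"
    and step: "a'\<^sup>2 \<le> a\<^sup>2 - m * \<rho>\<^sup>2 + 2 * c * \<epsilon> * (C * a + \<rho>)"
  shows "a' \<le> a + max (c * C) (c / sqrt m) * \<epsilon>"
proof -
  define K where "K = max (c * C) (c / sqrt m)"
  have K: "c * C \<le> K" "c / sqrt m \<le> K" "0 \<le> K" using c m by (auto simp: K_def le_max_iff_disj)
  have "0 \<le> (sqrt m * \<rho> - c * \<epsilon> / sqrt m)\<^sup>2" by simp
  also have "\<dots> = m * \<rho>\<^sup>2 - 2 * c * \<epsilon> * \<rho> + (c / sqrt m * \<epsilon>)\<^sup>2"
    using m by (simp add: power2_diff power_mult_distrib)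
  also have "(c / sqrt m * \<epsilon>)\<^sup>2 \<le> (K * \<epsilon>)\<^sup>2"
    using K c m \<open>0 \<le> \<epsilon>\<close> by (intro power_mono mult_right_mono) auto
  finally have "2 * c * \<epsilon> * \<rho> - m * \<rho>\<^sup>2 \<le> (K * \<epsilon>)\<^sup>2" by simp
  moreover have "c * C * (\<epsilon> * a) \<le> K * (\<epsilon> * a)" using K assms by (intro mult_right_mono) auto
  ultimately have "a'\<^sup>2 \<le> (a + K * \<epsilon>)\<^sup>2"
    using step by (simp add: power2_sum algebra_simps)
  then have "a' \<le> a + K * \<epsilon>"
    by (rule power2_le_imp_le) (use K \<open>0 \<le> a\<close> \<open>0 \<le> \<epsilon>\<close> in simp)
  then show ?thesis by (simp only: K_def)
qed

lemma perturbed_descent_residual: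
  fixes a \<rho> \<epsilon> :: "nat \<Rightarrow> real"
  assumes \<epsilon>: "\<epsilon> \<longlonglongrightarrow> 0" and m: "m > 0" and a: "convergent a"
    and step: "\<And>k. (a (Suc k))\<^sup>2 \<le> (a k)\<^sup>2 - m * (\<rho> k)\<^sup>2 + 2 * c * \<epsilon> k * (C * a k + \<rho> k)"
  shows "\<rho> \<longlonglongrightarrow> 0"
proof -
  obtain l where l: "a \<longlonglongrightarrow> l" using a by (auto simp: convergent_def)
  \<comment> \<open>Here half of m \<rho>^2 absorbs the term linear in \<rho>, at the price 2 (c
    \<epsilon>)^2 / m; the other half remains on the left and is bounded by a sequence tending to
    0.\<close>
  define h where "h k = (2 / m) * ((a k)\<^sup>2 - (a (Suc k))\<^sup>2 + 2 * c * \<epsilon> k * (C * a k) + 2 * (c * \<epsilon> k)\<^sup>2 / m)" for k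
  have "h \<longlonglongrightarrow> (2 / m) * (l\<^sup>2 - l\<^sup>2 + 2 * c * 0 * (C * l) + 2 * (c * 0)\<^sup>2 / m)"
    unfolding h_def using m by (intro tendsto_intros l LIMSEQ_Suc[OF l] \<epsilon>) auto
  then have "h \<longlonglongrightarrow> 0" by simp
  moreover have "(\<rho> k)\<^sup>2 \<le> h k" for k
  proof -
    have "0 \<le> (m * \<rho> k - 2 * c * \<epsilon> k)\<^sup>2 / (2 * m)" using m by simp
    also have "\<dots> = m * (\<rho> k)\<^sup>2 / 2 - 2 * c * \<epsilon> k * \<rho> k + 2 * (c * \<epsilon> k)\<^sup>2 / m"
      using m by (simp add: power2_diff field_simps power2_eq_square)
    finally have "m * (\<rho> k)\<^sup>2 / 2
      \<le> (a k)\<^sup>2 - (a (Suc k))\<^sup>2 + 2 * c * \<epsilon> k * (C * a k) + 2 * (c * \<epsilon> k)\<^sup>2 / m"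
      using step[of k] by (simp add: distrib_left)
    then have "(2 / m) * (m * (\<rho> k)\<^sup>2 / 2) \<le> h k"
      unfolding h_def using m by (intro mult_left_mono) auto
    then show ?thesis using m by simp
  qed
  ultimately have "(\<lambda>k. (\<rho> k)\<^sup>2) \<longlonglongrightarrow> 0"
    by (intro tendsto_sandwich[of "\<lambda>_. 0" "\<lambda>k. (\<rho> k)\<^sup>2" sequentially h]) auto
  then have "(\<lambda>k. sqrt ((\<rho> k)\<^sup>2)) \<longlonglongrightarrow> sqrt 0" by (rule tendsto_real_sqrt)
  then show ?thesis by (simp add: tendsto_rabs_zero_iff)
qed

section \<open>Saddle points\<close>

locale composite_problem = mixing W E for W :: "real ^ 'N::finite ^ 'N" and E +
  fixes f :: "'N \<Rightarrow> real ^ 'n::finite \<Rightarrow> real" and g :: "'N \<Rightarrow> real ^ 'n \<Rightarrow> ereal" and L :: "'N \<Rightarrow> real"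
  assumes L_pos: "\<And>i. L i > 0"
    and f_convex: "\<And>i. convex_on UNIV (f i)"
    and f_smooth: "\<And>i. smooth_fun (L i) (f i)"
    and g_pcc: "\<And>i. proper_closed_convex (g i)"
begin

lemma proper: "g i w \<noteq> -\<infinity>" "\<exists>w. g i w \<noteq> \<infinity>"
  using g_pcc by (auto simp: proper_closed_convex_def)

text \<open>The KKT system: consensus, and (V as)_i - grad f_i(xs_i) is a subgradient of g_i at
  xs_i. Written as inequalities in \<open>ereal\<close>, the inclusion can be passed to limits
  through closed epigraphs.\<close>

definition stationary :: "('N, 'n) svec \<Rightarrow> ('N, 'n) svec \<Rightarrow> bool" where
  "stationary xs as \<longleftrightarrow> V_mat W *v xs = 0 \<and> (\<forall>i w. g i (agent xs i)
     + ereal ((agent (V_mat W *v as) i - gradient (f i) (agent xs i)) \<bullet> (w - agent xs i)) \<le> g i w)"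

text \<open>An infinite value at the point would make the left side of the inequality infinite,
  contradicting it at any w in the domain of \<open>g i\<close>.\<close>

lemma stationary_finite:
  assumes "stationary xs as"
  shows "g i (agent xs i) \<noteq> \<infinity>"
proof
  obtain w where "g i w \<noteq> \<infinity>" using proper(2) by blast
  moreover assume "g i (agent xs i) = \<infinity>"
  ultimately show False using assms by (auto simp: stationary_def dest!: spec[of _ i] spec[of _ w])
qed

lemma lagrangian_eq:
  "lagrangian f g W y as
    = G_sum g y + ereal (\<Sum>i\<in>UNIV. f i (agent y i) - agent (V_mat W *v as) i \<bullet> agent y i)"
proof -
  have "as \<bullet> (V_mat W *v y) = (\<Sum>i\<in>UNIV. agent (V_mat W *v as) i \<bullet> agent y i)"
    unfolding inner_V_mat by (rule inner_agent)
  then show ?thesis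
    by (cases "G_sum g y") (simp_all add: lagrangian_def F_sum_def sum_subtractf)
qed

lemma lagrangian_minimum_iff:
  "(\<forall>y. lagrangian f g W xs as \<le> lagrangian f g W y as) \<longleftrightarrow>
    (\<forall>i w. g i (agent xs i) + ereal (f i (agent xs i) - agent (V_mat W *v as) i \<bullet> agent xs i)
      \<le> g i w + ereal (f i w - agent (V_mat W *v as) i \<bullet> w))"
  unfolding lagrangian_eq
  by (rule separable_minimum_iff[where h = "\<lambda>i w. f i w - agent (V_mat W *v as) i \<bullet> w", OF proper])

text \<open>Moving \<open>V\<close> onto the multiplier decouples the minimization over the primal
  variable into one convex problem per agent, equivalent to its subgradient inequality. Maximality
  over the multiplier, on which the Lagrangian depends affinely, amounts to consensus.\<close>

lemma saddle_point_iff_stationary: "(xs, as) \<in> saddle_points f g W \<longleftrightarrow> stationary xs as"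
proof -
  define h where "h i w = f i w - agent (V_mat W *v as) i \<bullet> w" for i w
  have h_deriv: "GDERIV (h i) w :> gradient (f i) w - agent (V_mat W *v as) i" for i w
    unfolding h_def by (intro GDERIV_diff GDERIV_inner_right smooth_fun_GDERIV[OF f_smooth])
  have h_convex: "convex_on UNIV (h i)" for i
  proof (rule convex_onI)
    fix t :: real and u v assume "0 < t" "t < 1"
    then show "h i ((1 - t) *\<^sub>R u + t *\<^sub>R v) \<le> (1 - t) * h i u + t * h i v"
      using convex_onD[OF f_convex, of t u v i] by (simp add: h_def inner_add_right algebra_simps)
  qed simp
  have min: "(\<forall>y. lagrangian f g W xs as \<le> lagrangian f g W y as) \<longleftrightarrow>
    (\<forall>i w. g i (agent xs i) + ereal (h i (agent xs i)) \<le> g i w + ereal (h i w))"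
    unfolding lagrangian_minimum_iff h_def ..
  have sign: "- ((w - u) \<bullet> (a - b)) = (b - a) \<bullet> (w - u)" for a b u w :: "real ^ 'n"
    by (metis inner_commute inner_minus_left minus_diff_eq)
  have sub: "(\<forall>i w. g i (agent xs i) + ereal (h i (agent xs i)) \<le> g i w + ereal (h i w)) \<longleftrightarrow>
    (\<forall>i w. g i (agent xs i)
     + ereal ((agent (V_mat W *v as) i - gradient (f i) (agent xs i)) \<bullet> (w - agent xs i)) \<le> g i w)"
    (is "?min \<longleftrightarrow> ?sub")
  proof
    assume min: ?min
    show ?sub
    proof (intro allI)
      fix i w
      obtain p where "g i p \<noteq> \<infinity>" using proper(2) by blast
      with min have fin: "g i (agent xs i) \<noteq> \<infinity>" by (auto dest!: spec[of _ i] spec[of _ p])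
      have "g i (agent xs i)
          + ereal (- ((w - agent xs i) \<bullet> (gradient (f i) (agent xs i) - agent (V_mat W *v as) i))) \<le> g i w"
        by (rule convex_smooth_minimum_subgradient[where g = "g i" and h = "h i", OF _ _ fin h_deriv])
           (use min g_pcc in \<open>auto simp: proper_closed_convex_def\<close>)
      then show "g i (agent xs i)
          + ereal ((agent (V_mat W *v as) i - gradient (f i) (agent xs i)) \<bullet> (w - agent xs i)) \<le> g i w"
        unfolding sign .
    qed
  next
    assume sub: ?sub
    show ?min
    proof (intro allI)
      fix i w
      show "g i (agent xs i) + ereal (h i (agent xs i)) \<le> g i w + ereal (h i w)"
        by (rule subgradient_imp_convex_smooth_minimum[where g = "g i" and h = "h i", OF h_convex h_deriv])
           (use sub sign in simp)
    qed
  qed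
  have "V_mat W *v xs = 0" if saddle: "(xs, as) \<in> saddle_points f g W"
  proof -
    \<comment> \<open>Shifting the multiplier by -V xs raises the Lagrangian by |V xs|^2, so
      maximality forces V xs = 0.\<close>
    have le_as: "\<forall>y. lagrangian f g W xs as \<le> lagrangian f g W y as"
      and le: "lagrangian f g W xs (as - V_mat W *v xs) \<le> lagrangian f g W xs as"
      using saddle by (auto simp: saddle_points_def)
    \<comment> \<open>Finiteness is needed to cancel the value of \<open>G_sum\<close> from both
      sides of the comparison.\<close>
    have "\<bar>g i (agent xs i)\<bar> \<noteq> \<infinity>" for i
    proof -
      obtain p where "g i p \<noteq> \<infinity>" using proper(2) by blast
      then have "g i (agent xs i) \<noteq> \<infinity>"
        using le_as[unfolded min]
        by (auto dest!: spec[of _ i] spec[of _ p])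
      then show ?thesis using proper(1)[of i "agent xs i"] by (simp add: ereal_infinity_cases)
    qed
    then have "\<bar>G_sum g xs\<bar> \<noteq> \<infinity>" by (simp add: G_sum_def sum_Inf)
    then obtain G where "G_sum g xs = ereal G" by auto
    then have "(V_mat W *v xs) \<bullet> (V_mat W *v xs) \<le> 0"
      using le by (simp add: lagrangian_def inner_diff_left)
    then show ?thesis by (metis inner_ge_zero inner_eq_zero_iff order_antisym)
  qed
  moreover have "lagrangian f g W xs a \<le> lagrangian f g W xs b" if "V_mat W *v xs = 0" for a b
    using that by (simp add: lagrangian_def)
  ultimately show ?thesis unfolding stationary_def sub[symmetric] min[symmetric]
    by (auto simp: saddle_points_def)
qed

text \<open>On consensual vectors the coupling term vanishes and the Lagrangian is the objective, so
  minimality over all stacked vectors restricts to minimality over common values.\<close>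

lemma stationary_optimal:
  assumes stat: "stationary xs as" and xs: "xs = kron_vec (\<chi> i. 1) z"
  shows "optimal f g z"
proof -
  have "\<forall>y. lagrangian f g W xs as \<le> lagrangian f g W y as"
    using stat unfolding saddle_point_iff_stationary[symmetric] by (auto simp: saddle_points_def)
  moreover have "lagrangian f g W (kron_vec (\<chi> i. 1) y) as = objective f g y" for y
    by (simp add: lagrangian_def F_sum_def G_sum_def objective_def sum.distrib)
  ultimately have "objective f g z \<le> objective f g y" for y unfolding xs by metis
  moreover have "objective f g z \<noteq> \<infinity>"
    using stationary_finite[OF stat] by (simp add: objective_def sum_Pinfty xs)
  ultimately show ?thesis by (auto simp: optimal_def)
qed

end

section \<open>The inexact recursion\<close>

locale inexact_proximal_gradient = composite_problem W E f g L
  for W :: "real ^ 'N::finite ^ 'N" and E and f :: "'N \<Rightarrow> real ^ 'n::finite \<Rightarrow> real" and g and L +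
  fixes \<tau> :: "'N \<Rightarrow> real" and \<beta> :: real and \<epsilon> :: "nat \<Rightarrow> real"
    and d x \<alpha> xt \<alpha>t :: "nat \<Rightarrow> ('N, 'n) svec"
  assumes \<tau>: "\<And>i. 0 < \<tau> i \<and> \<tau> i < 2 / L i"
    and \<beta>_pos: "0 < \<beta>" and \<beta>_le: "\<beta> \<le> 0.5 / Max (range \<tau>)"
    and \<epsilon>_nonneg: "\<And>k. 0 \<le> \<epsilon> k" and \<epsilon>_summable: "summable (\<lambda>k. \<epsilon> (Suc k))"
    and error: "\<And>k i. norm (agent (d k) i) \<le> \<epsilon> k"
    and iteration: "D_iPGM f g W \<tau> \<beta> d x \<alpha> xt \<alpha>t"
begin

abbreviation "V \<equiv> V_mat W :: ('N, 'n) smat"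
abbreviation "T \<equiv> agent_diag \<tau> :: ('N, 'n) smat"
abbreviation "T_inv \<equiv> agent_diag (\<lambda>i. 1 / \<tau> i) :: ('N, 'n) smat"
abbreviation "H \<equiv> H_mat \<tau> \<beta> W :: ('N, 'n) bmat"
abbreviation "H1 \<equiv> H1_mat L \<tau> \<beta> W :: ('N, 'n) bmat"
abbreviation "u k \<equiv> col2 (x k) (\<alpha> k)"

lemma \<tau>_pos: "\<tau> i > 0" and \<tau>_neq_0: "\<tau> i \<noteq> 0"
  using \<tau>[of i] by auto

lemma \<tau>_le_Max: "\<tau> i \<le> Max (range \<tau>)"
  by simp

lemma Max_\<tau>_pos: "Max (range \<tau>) > 0"
  using \<tau>_pos \<tau>_le_Max less_le_trans by blast

text \<open>The factor 0.5 in the bound on \<beta> becomes the 2 that matches the spectral bound V^2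
  < 2 I.\<close>

lemma stepsizes_inverse: "2 * Max (range \<tau>) \<le> 1 / \<beta>"
  using \<beta>_le \<beta>_pos Max_\<tau>_pos by (simp add: field_simps)

lemma sqnorm_H: "sqnorm_mat H (col2 a b) = a \<bullet> (T_inv *v a) + (b \<bullet> b) / \<beta>"
proof -
  have "((1 / \<beta>) *\<^sub>R mat 1 :: ('N, 'n) smat) *v b = (1 / \<beta>) *\<^sub>R b"
    by (simp add: scaleR_matrix_vector_assoc[symmetric])
  then show ?thesis by (simp add: sqnorm_mat_def H_mat_eq \<tau>_neq_0)
qed

lemma sqnorm_H1:
  "sqnorm_mat H1 (col2 a b) = a \<bullet> (agent_diag (\<lambda>i. 1 / \<tau> i - L i / 2) *v a)
    + (b \<bullet> b) / \<beta> - (V *v b) \<bullet> (T *v (V *v b))"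
proof -
  have "((1 / \<beta>) *\<^sub>R mat 1 :: ('N, 'n) smat) *v b = (1 / \<beta>) *\<^sub>R b"
    by (simp add: scaleR_matrix_vector_assoc[symmetric])
  moreover have "b \<bullet> ((V ** (T ** V)) *v b) = (V *v b) \<bullet> (T *v (V *v b))"
    by (simp only: matrix_vector_mul_assoc[symmetric] inner_V_mat)
  ultimately show ?thesis
    by (simp add: sqnorm_mat_def H1_mat_eq[OF \<tau>_neq_0 V_mat_symmetric]
        matrix_vector_mult_diff_rdistrib inner_diff_right)
qed

lemma sqnorm_H_nonneg: "0 \<le> sqnorm_mat H z"
proof -
  obtain a b where z: "z = col2 a b" by (rule col2_exhaust)
  have "0 \<le> a \<bullet> (T_inv *v a)"
    using \<tau>_pos by (simp add: inner_agent less_imp_le sum_nonneg)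
  then show ?thesis using \<beta>_pos by (simp add: z sqnorm_H)
qed

lemma sqnorm_H_lower_bound:
  obtains h where "h > 0" "\<And>z :: real ^ (('N \<times> 'n) + ('N \<times> 'n)). h * (norm z)\<^sup>2 \<le> sqnorm_mat H z"
proof
  define h where "h = min (1 / Max (range \<tau>)) (1 / \<beta>)"
  show "h > 0" using \<beta>_pos Max_\<tau>_pos by (simp add: h_def)
  fix z :: "real ^ (('N \<times> 'n) + ('N \<times> 'n))"
  obtain a b where z: "z = col2 a b" by (rule col2_exhaust)
  have "h * (norm a)\<^sup>2 \<le> a \<bullet> (T_inv *v a)"
    unfolding norm_agent[of a] inner_agent sum_distrib_left
  proof (rule sum_mono)
    fix i
    have "h \<le> 1 / \<tau> i" using \<tau>_le_Max \<tau>_pos by (auto simp: h_def min_le_iff_disj frac_le)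
    then have "h * (norm (agent a i))\<^sup>2 \<le> (1 / \<tau> i) * (norm (agent a i))\<^sup>2"
      by (rule mult_right_mono) simp
    then show "h * (norm (agent a i))\<^sup>2 \<le> agent a i \<bullet> agent (T_inv *v a) i"
      by (simp add: dot_square_norm)
  qed
  moreover have "h * (norm b)\<^sup>2 \<le> (1 / \<beta>) * (norm b)\<^sup>2"
    by (intro mult_right_mono) (auto simp: h_def)
  ultimately show "h * (norm z)\<^sup>2 \<le> sqnorm_mat H z"
    by (simp add: z norm_col2 sqnorm_H dot_square_norm distrib_left)
qed

text \<open>In the primal block \<tau> < 2/L leaves a margin \<open>l\<close>. In the dual block,
  with t the largest step size, 1/\<beta> is at least 2 t, while V \<Gamma> V is at most t V^2, thus
  at most t (2 - w); the margin is t w.\<close>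

lemma sqnorm_H1_lower_bound:
  obtains m where "m > 0" "\<And>z :: real ^ (('N \<times> 'n) + ('N \<times> 'n)). m * (norm z)\<^sup>2 \<le> sqnorm_mat H1 z"
proof -
  have "0 < 1 / \<tau> i - L i / 2" for i using \<tau>[of i] L_pos[of i] by (simp add: field_simps)
  then obtain l where l: "l > 0" "\<And>i. l \<le> 1 / \<tau> i - L i / 2"
    using finite_range_pos_lower_bound[of "\<lambda>i. 1 / \<tau> i - L i / 2"] by metis
  obtain w where w: "w > 0" "\<And>b :: ('N, 'n) svec. (norm (V *v b))\<^sup>2 + w * (norm b)\<^sup>2 \<le> 2 * (norm b)\<^sup>2"
    using norm_V_mat_upper_bound by metis
  let ?t = "Max (range \<tau>)"
  define m where "m = min l (?t * w)"
  have "m * (norm z)\<^sup>2 \<le> sqnorm_mat H1 z" for z :: "real ^ (('N \<times> 'n) + ('N \<times> 'n))"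
  proof -
    obtain a b where z: "z = col2 a b" by (rule col2_exhaust)
    have "m * (norm a)\<^sup>2 \<le> a \<bullet> (agent_diag (\<lambda>i. 1 / \<tau> i - L i / 2) *v a)"
      unfolding norm_agent[of a] inner_agent sum_distrib_left
    proof (rule sum_mono)
      fix i
      have "m \<le> 1 / \<tau> i - L i / 2" using l(2)[of i] by (simp add: m_def min_le_iff_disj)
      then have "m * (norm (agent a i))\<^sup>2 \<le> (1 / \<tau> i - L i / 2) * (norm (agent a i))\<^sup>2"
        by (rule mult_right_mono) simp
      then show "m * (norm (agent a i))\<^sup>2
          \<le> agent a i \<bullet> agent (agent_diag (\<lambda>i. 1 / \<tau> i - L i / 2) *v a) i"
        by (simp add: dot_square_norm)
    qed
    moreover have "(V *v b) \<bullet> (T *v (V *v b)) \<le> ?t * (norm (V *v b))\<^sup>2"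
      unfolding norm_agent[of "V *v b"] inner_agent sum_distrib_left
      by (intro sum_mono) (simp add: dot_square_norm mult_right_mono)
    moreover have "m * (norm b)\<^sup>2 \<le> ?t * w * (norm b)\<^sup>2"
      by (intro mult_right_mono) (auto simp: m_def)
    moreover have "?t * (norm (V *v b))\<^sup>2 + ?t * w * (norm b)\<^sup>2 \<le> 2 * ?t * (norm b)\<^sup>2"
      using mult_left_mono[OF w(2)[of b], of ?t] Max_\<tau>_pos by (simp add: distrib_left mult_ac)
    moreover have "2 * ?t * (norm b)\<^sup>2 \<le> (1 / \<beta>) * (norm b)\<^sup>2"
      by (intro mult_right_mono stepsizes_inverse) simp
    ultimately show ?thesis
      by (simp add: z norm_col2 sqnorm_H1 dot_square_norm distrib_left)
  qed
  moreover have "m > 0" using l w Max_\<tau>_pos by (simp add: m_def)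
  ultimately show ?thesis using that by blast
qed

section \<open>One step of the recursion\<close>

lemma xt_eq: "xt k = prox (matrix_inv T) (G_sum g)
    (x k - T *v (gradient (F_sum f) (x k) - V *v \<alpha> k - d k))"
  and \<alpha>t_eq: "\<alpha>t k = \<alpha> k - \<beta> *\<^sub>R (V *v xt k)"
  using iteration by (auto simp: D_iPGM_def)

lemma x_Suc: "x (Suc k) = xt k - T *v (V *v (\<alpha> k - \<alpha>t k))"
  and \<alpha>_Suc: "\<alpha> (Suc k) = \<alpha>t k"
proof -
  have "u (Suc k) = u k - M_mat \<tau> W *v (u k - col2 (xt k) (\<alpha>t k))"
    using iteration by (auto simp: D_iPGM_def)
  then have "x (Suc k) = xt k - T *v (V *v (\<alpha> k - \<alpha>t k)) \<and> \<alpha> (Suc k) = \<alpha>t k"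
    by (simp add: M_mat_def matrix_vector_mul_assoc)
  then show "x (Suc k) = xt k - T *v (V *v (\<alpha> k - \<alpha>t k))" "\<alpha> (Suc k) = \<alpha>t k" by auto
qed

text \<open>The subgradient of \<open>g i\<close> at \<open>xt k\<close> exposed by the proximal
  step: 1/\<tau> times the difference between the prox argument and the prox output, with the prox
  argument expanded.\<close>

definition subgrad :: "nat \<Rightarrow> 'N \<Rightarrow> real ^ 'n" where
  "subgrad k i = (1 / \<tau> i) *\<^sub>R (agent (x k) i - agent (xt k) i) - gradient (f i) (agent (x k) i)
     + agent (V *v \<alpha> k) i + agent (d k) i"

text \<open>The conclusion does not mention the stationary point: its role is to provide, through
  its own subgradient inequality, the affine minorants under which \<open>prox\<close> attains its
  minimum.\<close>

lemma xt_subgradient: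
  assumes stat: "stationary xs as"
  shows "g i (agent (xt k) i) \<noteq> \<infinity>"
    and "g i (agent (xt k) i) + ereal (subgrad k i \<bullet> (w - agent (xt k) i)) \<le> g i w"
proof -
  define s where "s i = agent (V *v as) i - gradient (f i) (agent xs i)" for i
  have "\<exists>r. g i (agent xs i) = ereal r" for i
    using stationary_finite[OF stat] proper(1) by (metis ereal_cases)
  then obtain \<gamma> where \<gamma>: "\<And>i. g i (agent xs i) = ereal (\<gamma> i)" by metis
  have minorant: "ereal ((\<gamma> i - s i \<bullet> agent xs i) + s i \<bullet> w) \<le> g i w" for i w
  proof -
    have "ereal (\<gamma> i + s i \<bullet> (w - agent xs i)) \<le> g i w"
      using stat \<gamma> by (simp add: stationary_def s_def)
    then show ?thesis by (simp add: inner_diff_right algebra_simps)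
  qed
  have "subgrad k i = (1 / \<tau> i) *\<^sub>R
      (agent (x k - T *v (gradient (F_sum f) (x k) - V *v \<alpha> k - d k)) i - agent (xt k) i)"
    using \<tau>_neq_0[of i]
    by (simp add: subgrad_def gradient_F_sum[OF f_smooth] scaleR_diff_right algebra_simps)
  then show "g i (agent (xt k) i) \<noteq> \<infinity>"
    and "g i (agent (xt k) i) + ereal (subgrad k i \<bullet> (w - agent (xt k) i)) \<le> g i w"
    using prox_subgradient[OF g_pcc \<tau>_pos minorant xt_eq] by metis+
qed

text \<open>Per agent, the subgradient inequality at \<open>xt k\<close> is tested at xs and the one
  at xs is tested at \<open>xt k\<close>. Their sum removes the values of g, and the three-point
  inequality replaces the gradient difference by L/4 times the squared residual.\<close>

lemma monotonicity_gap:
  assumes stat: "stationary xs as"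
  shows "0 \<le> (x k - xt k) \<bullet> (T_inv *v (xt k - xs)) + (V *v (\<alpha> k - as)) \<bullet> (xt k - xs)
    + d k \<bullet> (xt k - xs) + (x k - xt k) \<bullet> (agent_diag L *v (x k - xt k)) / 4"
proof -
  have "0 \<le> (agent (x k) i - agent (xt k) i) \<bullet> ((1 / \<tau> i) *\<^sub>R (agent (xt k) i - agent xs i))
      + agent (V *v (\<alpha> k - as)) i \<bullet> (agent (xt k) i - agent xs i)
      + agent (d k) i \<bullet> (agent (xt k) i - agent xs i)
      + (agent (x k) i - agent (xt k) i) \<bullet> (L i *\<^sub>R (agent (x k) i - agent (xt k) i)) / 4" for i
  proof -
    define e where "e = agent (xt k) i - agent xs i"
    define c where "c = agent (V *v as) i - gradient (f i) (agent xs i)"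
    obtain r where r: "g i (agent (xt k) i) = ereal r"
      using xt_subgradient(1)[OF stat] proper(1) by (metis ereal_cases)
    obtain s where s: "g i (agent xs i) = ereal s"
      using stationary_finite[OF stat] proper(1) by (metis ereal_cases)
    have "r - subgrad k i \<bullet> e \<le> s"
      using xt_subgradient(2)[OF stat, of i k "agent xs i"]
      by (simp add: r s e_def inner_diff_right)
    moreover have "s + c \<bullet> e \<le> r"
      using stat[unfolded stationary_def, THEN conjunct2, rule_format, of i "agent (xt k) i"]
      by (simp add: r s e_def c_def)
    moreover have "- (L i / 4 * (norm (agent (x k) i - agent (xt k) i))\<^sup>2)
        \<le> (gradient (f i) (agent (x k) i) - gradient (f i) (agent xs i)) \<bullet> e"
      unfolding e_def by (rule gradient_three_point[OF f_smooth f_convex L_pos])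
    ultimately show ?thesis
      unfolding e_def[symmetric]
      by (simp add: subgrad_def c_def inner_add_left inner_diff_left dot_square_norm
          matrix_vector_mult_diff_distrib)
  qed
  then have "0 \<le> (\<Sum>i\<in>UNIV. (agent (x k) i - agent (xt k) i) \<bullet> ((1 / \<tau> i) *\<^sub>R (agent (xt k) i - agent xs i))
      + agent (V *v (\<alpha> k - as)) i \<bullet> (agent (xt k) i - agent xs i)
      + agent (d k) i \<bullet> (agent (xt k) i - agent xs i)
      + (agent (x k) i - agent (xt k) i) \<bullet> (L i *\<^sub>R (agent (x k) i - agent (xt k) i)) / 4)"
    by (rule sum_nonneg)
  then show ?thesis
    unfolding inner_agent sum.distrib sum_divide_distrib by simp
qed

text \<open>Expressed through the primal error e, the primal residual r, the dual error p and the
  dual residual s, the right side minus the left side is exactly twice the expression in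
  \<open>monotonicity_gap\<close>.\<close>

lemma descent:
  assumes stat: "stationary xs as"
  shows "sqnorm_mat H (u (Suc k) - col2 xs as)
    \<le> sqnorm_mat H (u k - col2 xs as) - sqnorm_mat H1 (u k - col2 (xt k) (\<alpha>t k))
      + 2 * ((xt k - xs) \<bullet> d k)"
proof -
  define e r p s where "e = xt k - xs" and "r = x k - xt k" and "p = \<alpha> k - as" and "s = \<alpha> k - \<alpha>t k"
  define q where "q = T *v (V *v s)"
  have Vxs: "V *v xs = 0" using stat by (simp add: stationary_def)
  \<comment> \<open>Since V xs = 0, the dual residual measures the consensus violation of e. This
    turns every pairing of \<open>V\<close> with e into a scalar product with s.\<close>
  have "s = \<beta> *\<^sub>R (V *v e)"
    by (simp add: s_def \<alpha>t_eq e_def matrix_vector_mult_diff_distrib Vxs)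
  then have Ve: "V *v e = (1 / \<beta>) *\<^sub>R s" using \<beta>_pos by simp
  have Ts: "y \<bullet> (T_inv *v z) = (T_inv *v y) \<bullet> z" for y z :: "('N, 'n) svec"
    by (rule symmetric_matrix_inner) simp
  \<comment> \<open>The correction q carries the factor \<Gamma>, which the primal metric undoes.
    The remaining term (V s).q is the one that \<open>H1\<close> subtracts.\<close>
  have Tq: "T_inv *v q = V *v s"
    using agent_diag_inverse_cancel(1)[of \<tau> V, OF \<tau>_neq_0]
    unfolding q_def by (simp only: matrix_vector_mul_assoc matrix_mul_assoc)
  have "x (Suc k) - xs = e - q" "\<alpha> (Suc k) - as = p - s" "x k - xs = e + r"
    by (simp_all add: x_Suc \<alpha>_Suc e_def q_def s_def p_def r_def)
  moreover have "sqnorm_mat H (col2 (e - q) (p - s))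
    = e \<bullet> (T_inv *v e) - 2 * (e \<bullet> (V *v s)) + (V *v s) \<bullet> q + (p \<bullet> p - 2 * (p \<bullet> s) + s \<bullet> s) / \<beta>"
    using Ts[of q e] by (simp add: sqnorm_H matrix_vector_mult_diff_distrib inner_diff_left
        inner_diff_right Tq inner_commute)
  moreover have "sqnorm_mat H (col2 (e + r) p)
    = e \<bullet> (T_inv *v e) + 2 * (r \<bullet> (T_inv *v e)) + r \<bullet> (T_inv *v r) + (p \<bullet> p) / \<beta>"
    using Ts[of r e] by (simp add: sqnorm_H matrix_vector_right_distrib inner_add_left
        inner_add_right inner_commute)
  moreover have "sqnorm_mat H1 (col2 r s)
    = r \<bullet> (T_inv *v r) - r \<bullet> (agent_diag L *v r) / 2 + (s \<bullet> s) / \<beta> - (V *v s) \<bullet> q"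
  proof -
    have "agent_diag (\<lambda>i. 1 / \<tau> i - L i / 2) *v r = T_inv *v r - (1 / 2) *\<^sub>R (agent_diag L *v r)"
      by (rule agent_eqI) (simp add: scaleR_diff_left)
    then show ?thesis by (simp add: sqnorm_H1 q_def inner_diff_right)
  qed
  moreover have "e \<bullet> (V *v s) = (s \<bullet> s) / \<beta>" "(V *v p) \<bullet> e = (p \<bullet> s) / \<beta>"
    unfolding inner_V_mat[of e s] inner_V_mat[of p e, symmetric] Ve by simp_all
  moreover have "0 \<le> r \<bullet> (T_inv *v e) + (V *v p) \<bullet> e + d k \<bullet> e + r \<bullet> (agent_diag L *v r) / 4"
    using monotonicity_gap[OF stat, of k] unfolding e_def r_def p_def .
  moreover have "u (Suc k) - col2 xs as = col2 (x (Suc k) - xs) (\<alpha> (Suc k) - as)"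
    "u k - col2 xs as = col2 (x k - xs) p" "u k - col2 (xt k) (\<alpha>t k) = col2 r s"
    "(xt k - xs) \<bullet> d k = d k \<bullet> e"
    by (simp_all add: p_def r_def s_def e_def inner_commute)
  ultimately show ?thesis by (simp add: add_divide_distrib diff_divide_distrib)
qed

section \<open>Asymptotics of the iterates\<close>

lemma norm_error: "norm (d k) \<le> sqrt (real CARD('N)) * \<epsilon> k"
proof (rule power2_le_imp_le)
  have "(norm (d k))\<^sup>2 \<le> (\<Sum>i\<in>(UNIV :: 'N set). (\<epsilon> k)\<^sup>2)"
    unfolding norm_agent[of "d k"] by (intro sum_mono power_mono error) simp
  then show "(norm (d k))\<^sup>2 \<le> (sqrt (real CARD('N)) * \<epsilon> k)\<^sup>2"
    by (simp add: power_mult_distrib)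
qed (simp add: \<epsilon>_nonneg)

text \<open>Both claims come from one scalar recursion linking the H-distance \<open>a\<close> and
  the residual norm \<rho>; Cauchy-Schwarz on the error term produces it from the descent
  inequality.\<close>

lemma distance_convergent:
  assumes stat: "stationary xs as"
  shows "convergent (\<lambda>k. sqrt (sqnorm_mat H (u k - col2 xs as)))"
    and "(\<lambda>k. norm (u k - col2 (xt k) (\<alpha>t k))) \<longlonglongrightarrow> 0"
proof -
  obtain h where h: "h > 0" "\<And>z. h * (norm z)\<^sup>2 \<le> sqnorm_mat H z"
    using sqnorm_H_lower_bound by metis
  obtain m where m: "m > 0" "\<And>z. m * (norm z)\<^sup>2 \<le> sqnorm_mat H1 z"
    using sqnorm_H1_lower_bound by metis
  define a where "a k = sqrt (sqnorm_mat H (u k - col2 xs as))" for k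
  define \<rho> where "\<rho> k = norm (u k - col2 (xt k) (\<alpha>t k))" for k
  define c where "c = sqrt (real CARD('N))"
  define C where "C = 1 / sqrt h"
  have a: "0 \<le> a k" "(a k)\<^sup>2 = sqnorm_mat H (u k - col2 xs as)" for k
    by (simp_all add: a_def sqnorm_H_nonneg)
  \<comment> \<open>The error is paired with xt - xs, whereas \<open>a\<close> controls x - xs. The
    detour through \<open>x k\<close> costs one residual, which the negative term of the recursion
    can absorb.\<close>
  have dist: "norm (xt k - xs) \<le> C * a k + \<rho> k" for k
  proof -
    have fst_le: "norm y \<le> norm (col2 y z)" for y z :: "('N, 'n) svec"
      by (rule power2_le_imp_le) (simp_all add: norm_col2)
    have "sqrt h * norm (u k - col2 xs as) \<le> a k"
      by (rule power2_le_imp_le) (use h a in \<open>simp_all add: power_mult_distrib\<close>)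
    then have "norm (u k - col2 xs as) \<le> C * a k" using h by (simp add: C_def field_simps)
    moreover have "norm (x k - xs) \<le> norm (u k - col2 xs as)" "norm (x k - xt k) \<le> \<rho> k"
      by (simp_all add: \<rho>_def fst_le)
    moreover have "norm (xt k - xs) \<le> norm (x k - xs) + norm (x k - xt k)"
      using norm_triangle_ineq4[of "x k - xs" "x k - xt k"] by simp
    ultimately show ?thesis by linarith
  qed
  have step: "(a (Suc k))\<^sup>2 \<le> (a k)\<^sup>2 - m * (\<rho> k)\<^sup>2 + 2 * c * \<epsilon> k * (C * a k + \<rho> k)" for k
  proof -
    have "(xt k - xs) \<bullet> d k \<le> norm (xt k - xs) * norm (d k)" by (rule norm_cauchy_schwarz)
    also have "\<dots> \<le> (C * a k + \<rho> k) * (c * \<epsilon> k)"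
      unfolding c_def using dist[of k] by (intro mult_mono norm_error) (auto intro: order_trans[OF norm_ge_zero])
    finally have "(xt k - xs) \<bullet> d k \<le> (C * a k + \<rho> k) * (c * \<epsilon> k)" .
    moreover have "2 * c * \<epsilon> k * (C * a k + \<rho> k) = 2 * ((C * a k + \<rho> k) * (c * \<epsilon> k))"
      by (simp only: mult_ac)
    ultimately show ?thesis using descent[OF stat, of k] m(2)[of "u k - col2 (xt k) (\<alpha>t k)"]
      unfolding a(2) \<rho>_def[symmetric] by linarith
  qed
  \<comment> \<open>The hypothesis starts at index 1, whereas the recursion also uses \<epsilon> at
    0; one extra term does not affect summability.\<close>
  have sum: "summable \<epsilon>" using \<epsilon>_summable by (simp add: summable_Suc_iff)
  show conv: "convergent a"
  proof (rule almost_decreasing_convergent[OF a(1)])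
    show "a (Suc k) \<le> a k + max (c * C) (c / sqrt m) * \<epsilon> k" for k
      by (rule perturbed_descent_step[OF a(1) \<epsilon>_nonneg m(1) _ _ step]) (use h in \<open>simp_all add: c_def C_def\<close>)
    show "summable (\<lambda>k. max (c * C) (c / sqrt m) * \<epsilon> k)" using sum by (rule summable_mult)
  qed
  show "\<rho> \<longlonglongrightarrow> 0"
    by (rule perturbed_descent_residual[OF summable_LIMSEQ_zero[OF sum] m(1) conv step])
qed

lemma iterates_bounded:
  assumes stat: "stationary xs as"
  shows "bounded (range u)"
proof -
  obtain h where h: "h > 0" "\<And>z. h * (norm z)\<^sup>2 \<le> sqnorm_mat H z"
    using sqnorm_H_lower_bound by metis
  obtain B where B: "\<And>k. sqrt (sqnorm_mat H (u k - col2 xs as)) \<le> B"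
    using convergent_imp_Bseq[OF distance_convergent(1)[OF stat]] by (auto simp: Bseq_def abs_le_iff)
  have "norm (u k - col2 xs as) \<le> B / sqrt h" for k
  proof -
    have "sqrt h * norm (u k - col2 xs as) \<le> sqrt (sqnorm_mat H (u k - col2 xs as))"
      by (rule real_le_rsqrt) (use h in \<open>simp add: power_mult_distrib\<close>)
    with B[of k] show ?thesis using h by (simp add: field_simps)
  qed
  then show ?thesis
    by (intro boundedI[of _ "B / sqrt h + norm (col2 xs as)"])
       (metis (no_types, lifting) add.commute add_left_mono norm_triangle_sub order_trans rangeE)
qed

text \<open>Vanishing residuals give \<open>xt\<close> the same limit as \<open>x\<close> along the
  subsequence, and the dual update turns a vanishing dual residual into V xl = 0. The proximal
  subgradients converge because the gradients are continuous and the errors vanish.\<close>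

lemma cluster_point_stationary:
  assumes stat: "stationary xs as" and r: "strict_mono r"
    and lim: "(u \<circ> r) \<longlonglongrightarrow> col2 xl al"
  shows "stationary xl al"
proof -
  have x: "(\<lambda>k. x (r k)) \<longlonglongrightarrow> xl" and \<alpha>: "(\<lambda>k. \<alpha> (r k)) \<longlonglongrightarrow> al"
    using lim by (simp_all add: o_def tendsto_col2_iff)
  have "(\<lambda>k. norm (u (r k) - col2 (xt (r k)) (\<alpha>t (r k)))) \<longlonglongrightarrow> 0"
    using LIMSEQ_subseq_LIMSEQ[OF distance_convergent(2)[OF stat] r] by (simp add: o_def)
  then have "(\<lambda>k. col2 (x (r k) - xt (r k)) (\<alpha> (r k) - \<alpha>t (r k))) \<longlonglongrightarrow> col2 0 0"
    by (simp add: tendsto_norm_zero_iff)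
  then have res: "(\<lambda>k. x (r k) - xt (r k)) \<longlonglongrightarrow> 0" "(\<lambda>k. \<alpha> (r k) - \<alpha>t (r k)) \<longlonglongrightarrow> 0"
    unfolding tendsto_col2_iff by simp_all
  have xt: "(\<lambda>k. xt (r k)) \<longlonglongrightarrow> xl" using tendsto_diff[OF x res(1)] by simp
  have mat: "(\<lambda>k. V *v y k) \<longlonglongrightarrow> V *v z" if "y \<longlonglongrightarrow> z" for y :: "nat \<Rightarrow> ('N, 'n) svec" and z
    using that by (rule bounded_linear.tendsto[OF matrix_vector_mul_bounded_linear])
  have "(\<lambda>k. \<beta> *\<^sub>R (V *v xt (r k))) \<longlonglongrightarrow> \<beta> *\<^sub>R (V *v xl)" by (intro tendsto_intros mat xt)
  moreover have "(\<lambda>k. \<beta> *\<^sub>R (V *v xt (r k))) \<longlonglongrightarrow> 0" using res(2) by (simp add: \<alpha>t_eq)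
  ultimately have "\<beta> *\<^sub>R (V *v xl) = 0" by (rule LIMSEQ_unique)
  then have "V *v xl = 0" using \<beta>_pos by simp
  moreover have "g i (agent xl i)
     + ereal ((agent (V *v al) i - gradient (f i) (agent xl i)) \<bullet> (w - agent xl i)) \<le> g i w" for i w
  proof (cases "g i w")
    case (real b)
    have "continuous_on UNIV (gradient (f i))"
      using f_smooth[of i] by (auto simp: smooth_fun_def intro: lipschitz_on_continuous_on)
    then have "isCont (gradient (f i)) (agent xl i)" by (simp add: continuous_on_eq_continuous_at)
    then have grad: "(\<lambda>k. gradient (f i) (agent (x (r k)) i)) \<longlonglongrightarrow> gradient (f i) (agent xl i)"
      by (rule isCont_tendsto_compose) (intro tendsto_intros x)
    have "summable \<epsilon>" using \<epsilon>_summable by (simp add: summable_Suc_iff)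
    then have "(\<lambda>k. \<epsilon> (r k)) \<longlonglongrightarrow> 0"
      using LIMSEQ_subseq_LIMSEQ[OF summable_LIMSEQ_zero r] by (simp add: o_def)
    then have err: "(\<lambda>k. agent (d (r k)) i) \<longlonglongrightarrow> 0"
      by (rule Lim_null_comparison[rotated]) (simp add: error)
    \<comment> \<open>The subgradient inequality against w says that the point with height
      \<open>b - y k\<close> lies in the epigraph over the current agent value. No convergence of
      the values of \<open>g i\<close> is needed: only points of a closed set are passed to the
      limit.\<close>
    define y where "y k = subgrad (r k) i \<bullet> (w - agent (xt (r k)) i)" for k
    have "(\<lambda>k. subgrad (r k) i) \<longlonglongrightarrow> (1 / \<tau> i) *\<^sub>R (agent xl i - agent xl i)
        - gradient (f i) (agent xl i) + agent (V *v al) i + 0"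
      unfolding subgrad_def by (intro tendsto_intros x xt grad err mat \<alpha>)
    then have "y \<longlonglongrightarrow> (agent (V *v al) i - gradient (f i) (agent xl i)) \<bullet> (w - agent xl i)"
      (is "_ \<longlonglongrightarrow> ?y") unfolding y_def by (intro tendsto_intros xt) simp
    then have lim_epi: "(\<lambda>k. (agent (xt (r k)) i, b - y k)) \<longlonglongrightarrow> (agent xl i, b - ?y)"
      by (intro tendsto_intros xt)
    have in_epi: "(agent (xt (r k)) i, b - y k) \<in> ereal_epigraph (g i)" for k
    proof -
      obtain s where s: "g i (agent (xt (r k)) i) = ereal s"
        using xt_subgradient(1)[OF stat] proper(1) by (metis ereal_cases)
      have "s + y k \<le> b"
        using xt_subgradient(2)[OF stat, of i "r k" w] by (simp add: real s y_def)
      then show ?thesis by (simp add: ereal_epigraph_def s)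
    qed
    have "closed (ereal_epigraph (g i))" using g_pcc by (simp add: proper_closed_convex_def)
    then have "(agent xl i, b - ?y) \<in> ereal_epigraph (g i)"
      using in_epi lim_epi by (rule closed_sequentially)
    then have "g i (agent xl i) + ereal ?y \<le> ereal (b - ?y) + ereal ?y"
      by (intro add_right_mono) (simp add: ereal_epigraph_def)
    then show ?thesis by (simp add: real)
  qed (use proper(1) in auto)
  ultimately show ?thesis by (simp add: stationary_def)
qed

text \<open>Convergence of the distance holds for every stationary reference point, so a cluster
  point may itself be the reference. The limit of that distance is zero because it is zero along the
  subsequence defining the point.\<close>

lemma iterates_converge:
  assumes stat: "stationary xs as"
  obtains xl al where "stationary xl al" "u \<longlonglongrightarrow> col2 xl al"
proof -
  obtain l r where r: "strict_mono r" "(u \<circ> r) \<longlonglongrightarrow> l"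
    using bounded_imp_convergent_subsequence[OF iterates_bounded[OF stat]] by blast
  obtain xl al where l: "l = col2 xl al" by (rule col2_exhaust)
  have lim: "stationary xl al" using cluster_point_stationary[OF stat r(1)] r(2) l by simp
  obtain h where h: "h > 0" "\<And>z. h * (norm z)\<^sup>2 \<le> sqnorm_mat H z"
    using sqnorm_H_lower_bound by metis
  define a where "a k = sqrt (sqnorm_mat H (u k - l))" for k
  obtain q where q: "a \<longlonglongrightarrow> q"
    using distance_convergent(1)[OF lim] unfolding l[symmetric] a_def[symmetric]
    by (auto simp: convergent_def)
  have "(\<lambda>k. sqrt (sqnorm_mat H ((u \<circ> r) k - l))) \<longlonglongrightarrow> sqrt (sqnorm_mat H (l - l))"
    unfolding sqnorm_mat_def
    by (intro tendsto_intros r(2) bounded_linear.tendsto[OF matrix_vector_mul_bounded_linear])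
  then have "(a \<circ> r) \<longlonglongrightarrow> 0" by (simp add: a_def o_def sqnorm_mat_def)
  with LIMSEQ_subseq_LIMSEQ[OF q r(1)] have "q = 0" by (rule LIMSEQ_unique)
  \<comment> \<open>The lower bound on the metric transfers convergence from the H-distance to the
    Euclidean norm.\<close>
  have "(\<lambda>k. norm (u k - l)) \<longlonglongrightarrow> 0"
  proof (rule Lim_null_comparison)
    show "\<forall>\<^sub>F k in sequentially. norm (norm (u k - l)) \<le> a k / sqrt h"
    proof (intro always_eventually allI)
      fix k
      have "sqrt h * norm (u k - l) \<le> a k"
        unfolding a_def by (rule real_le_rsqrt) (use h in \<open>simp add: power_mult_distrib\<close>)
      then show "norm (norm (u k - l)) \<le> a k / sqrt h" using h by (simp add: field_simps)
    qed
    show "(\<lambda>k. a k / sqrt h) \<longlonglongrightarrow> 0"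
      using tendsto_divide[OF q tendsto_const[of "sqrt h"]] \<open>q = 0\<close> h by simp
  qed
  then have "u \<longlonglongrightarrow> l" by (simp add: tendsto_norm_zero_iff LIM_zero_iff)
  with lim l show ?thesis by (intro that[of xl al]) auto
qed

end

theorem theorem1:
  fixes f :: "'N::finite \<Rightarrow> real ^ 'n::finite \<Rightarrow> real"
    and g :: "'N \<Rightarrow> real ^ 'n \<Rightarrow> ereal"
    and L \<tau> :: "'N \<Rightarrow> real"
    and \<beta> :: real
    and E :: "('N \<times> 'N) set"
    and W :: "real ^ 'N ^ 'N"
    and \<epsilon> :: "nat \<Rightarrow> real"
    and d x \<alpha> xt \<alpha>t :: "nat \<Rightarrow> ('N, 'n) svec"
  assumes "\<And>i. L i > 0"
    and "\<And>i. convex_on UNIV (f i)"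
    and "\<And>i. smooth_fun (L i) (f i)"
    and "\<And>i. proper_closed_convex (g i)"
    and "\<exists>z. optimal f g z"
    and "undirected_connected E"
    and "mixing_matrix E W"
    and "saddle_points f g W \<noteq> {}"
    and "\<And>i. 0 < \<tau> i \<and> \<tau> i < 2 / L i"
    and "0 < \<beta>" and "\<beta> \<le> 0.5 / Max (range \<tau>)"
    and "\<And>k. 0 \<le> \<epsilon> k"
    and "summable (\<lambda>k. \<epsilon> (Suc k))"
    and "\<And>k i. norm (agent (d k) i) \<le> \<epsilon> k"
    and "D_iPGM f g W \<tau> \<beta> d x \<alpha> xt \<alpha>t"
  shows "(\<forall>(xs, \<alpha>s) \<in> saddle_points f g W. \<forall>k.
            sqnorm_mat (H_mat \<tau> \<beta> W) (col2 (x (Suc k)) (\<alpha> (Suc k)) - col2 xs \<alpha>s)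
              \<le> sqnorm_mat (H_mat \<tau> \<beta> W) (col2 (x k) (\<alpha> k) - col2 xs \<alpha>s)
                - sqnorm_mat (H1_mat L \<tau> \<beta> W) (col2 (x k) (\<alpha> k) - col2 (xt k) (\<alpha>t k))
                + 2 * ((xt k - xs) \<bullet> d k))
       \<and> bounded (range (\<lambda>k. col2 (x k) (\<alpha> k)))
       \<and> (\<exists>(xl, \<alpha>l) \<in> saddle_points f g W.
            (\<lambda>k. col2 (x k) (\<alpha> k)) \<longlonglongrightarrow> col2 xl \<alpha>l \<and>
            (\<exists>z. xl = kron_vec (\<chi> i. 1) z \<and> optimal f g z))"
proof -
  interpret inexact_proximal_gradient W E f g L \<tau> \<beta> \<epsilon> d x \<alpha> xt \<alpha>t
    by unfold_locales (use assms in auto)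
  \<comment> \<open>Any saddle point may start the argument; the limit found from it need not be the
    same one.\<close>
  obtain xs as where stat: "stationary xs as"
    using assms(8) by (auto simp: saddle_point_iff_stationary)
  obtain xl al where lim: "stationary xl al" "u \<longlonglongrightarrow> col2 xl al"
    using iterates_converge[OF stat] by metis
  obtain z where z: "xl = kron_vec (\<chi> i. 1) z"
    using V_mat_eq_0_imp_consensus lim(1) unfolding stationary_def by metis
  have "(xl, al) \<in> saddle_points f g W" by (simp add: saddle_point_iff_stationary lim)
  moreover have "optimal f g z" by (rule stationary_optimal[OF lim(1) z])
  ultimately show ?thesis
    using lim(2) z descent iterates_bounded[OF stat]
    by (intro conjI bexI[of _ "(xl, al)"]) (auto simp only: saddle_point_iff_stationary)
qed

end
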